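(* Fix a bipartite graph with $n\ge3$ vertices and $m\ge1$ edges. 1. There is a polynomial-time algorithm such that for all $\delta,\varepsilon>0$ and every distribution $\mathcal D$ over (cost, demand, feature) triples in $\mathbb Z_{\ge0}^m\times\mathbb Z_{\ge0}^n\times\triangle_f$ such that the $\ell_\infty$-norms of the first two are bounded by $C$ and $B$, respectively, it takes $O\big((\tfrac{CBn}\varepsilon)^2(f^2+\log\tfrac1\delta)\big)$ i.i.d. samples from $\mathcal D$ and returns $\hat{\mathbf A}\in\mathbb R^{n\times f}$ such that with probability at least $1-\delta$ $$\mathbb E_{(\mathbf c,\mathbf b,\mathbf f)\sim\mathcal D}\|\hat{\mathbf A}\mathbf f-\mathbf x^*(\mathbf c,\mathbf b)\|_{\mathbf b,1}\le\min_{\|\mathbf A\|_{\max}\le C}\mathbb E_{(\mathbf c,\mathbf b,\mathbf f)\sim\mathcal D}\|\mathbf A\mathbf f-\mathbf x^*(\mathbf c,\mathbf b)\|_{\mathbf b,1}+\varepsilon.$$ 2. Let $(\mathbf c_1,\mathbf b_1,\mathbf f_1),\dots,(\mathbf c_T,\mathbf b_T,\mathbf f_T)\in\mathbb Z_{\ge0}^m\times\mathbb Z_{\ge0}^n\times\triangle_f$ be any (adversarial) sequence of triples such that the $\ell_\infty$-norms of the first two components are bounded by $C$ and $B$, respectively. Then projected online subgradient descent (OGD) over $[-C,C]^{n\times f}$ on the losses $\mathbf A\mapsto\|\mathbf A\mathbf f_t-\mathbf x^*(\mathbf c_t,\mathbf b_t)\|_{\mathbf b_t,1}$, with appropriate step-size,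 has regret $$\max_{\|\mathbf A\|_{\max}\le C}\sum_{t=1}^T\Big(\|\mathbf A_t\mathbf f_t-\mathbf x^*(\mathbf c_t,\mathbf b_t)\|_{\mathbf b_t,1}-\|\mathbf A\mathbf f_t-\mathbf x^*(\mathbf c_t,\mathbf b_t)\|_{\mathbf b_t,1}\Big)\le CBnf\sqrt{2T}.$$
   Context: For $\mathbf b\in\mathbb R_{\ge0}^n$ the $\mathbf b$-seminorm is $\|\mathbf x\|_{\mathbf b,1}=\sum_{i=1}^n\mathbf b_{[i]}|\mathbf x_{[i]}|$. $\triangle_f$ is the probability simplex in $\mathbb R^f$; $\|\mathbf A\|_{\max}$ is the largest absolute value of an entry of $\mathbf A$. Minimum-weight perfect $\mathbf b$-matching: given edge costs $\mathbf c$ and vertex demands $\mathbf b$, choose nonnegative integer edge multiplicities $z_e$ with $\sum_{e\ni i}z_e=\mathbf b_{[i]}$ for every vertex $i$, minimizing $\sum_e\mathbf c_{[e]}z_e$; all demands considered are assumed to admit such a solution. The LP dual is: maximize $\sum_i\mathbf b_{[i]}\mathbf x_{[i]}$ subject to $\mathbf x_{[u]}+\mathbf x_{[v]}\le\mathbf c_{[uv]}$ for every edge $uv$. $\mathbf x^*(\mathbf c,\mathbf b)\in\mathbb Z^n$ denotes a fixed choice of integral optimal dual solution, namely the one returned by a polynomial-time primal-dual algorithm for the problem. Constants in the sample-complexity $O(\cdot)$ are universal and the bound is understood in the usual asymptotic sense as $\varepsilon,\delta\to0$ (e.g. $\delta\le1/2$, at least one sample). OGD on a closed convex set $\mathcal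 X\ni0$ with step-size $\alpha>0$: $\mathbf x_1=0$, and after observing loss $U_t$, $\mathbf x_{t+1}=\arg\min_{\mathbf x\in\mathcal X}\alpha\langle\mathbf g_t,\mathbf x\rangle+\frac12\|\mathbf x-\mathbf x_t\|_2^2$ with $\mathbf g_t$ a subgradient of $U_t$ at $\mathbf x_t$; matrices are viewed as vectors with the Frobenius inner product. "With appropriate step-size" means that there is a choice of $\alpha$ (depending on $T$ and the given bounds) for which the inequality holds. *)

theory Defs
  imports
    "HOL-Probability.Probability"
    "HOL-Computational_Algebra.Polynomial"
    "HOL-Library.Log_Nat"
begin

text \<open>
  Vectors and matrices over \<open>{..<n}\<close> and \<open>{..<n} \<times> {..<f}\<close> are functions on natural numbers of which
  only the entries in range matter. Costs, demands and features are moreover extensional, i.e. elements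
  of the spaces of the product measures over which distributions are considered.
\<close>


section \<open>Polynomial time with real inputs\<close>

text \<open>
  Features are real vectors, so running times refer to a real-number model: programs over
  S-expressions whose atoms are reals, where every arithmetic operation, comparison and pointer
  operation costs one unit. Copying a value costs one unit because it copies a pointer. Program
  constants are rational, so that no non-uniform advice can be hidden in a real constant, and there is
  no rounding operation.
\<close>

datatype val = VNum real | VNil | VCons val val

datatype prog =
    Ident | Const rat | Empty | Head | Tail
  | Construct prog prog | Comp prog prog
  | Add | Sub | Mult | Div | Less
  | Cond prog prog prog | While prog prog

text \<open>
  \<open>exec p v w t\<close>: on input \<open>v\<close>, the program \<open>p\<close> halts with output \<open>w\<close> after \<open>t\<close> steps. The value
  \<^const>\<open>VNil\<close> is read as false and any other value as true. \<open>Comp p q\<close> runs \<open>p\<close> first.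
\<close>

inductive exec :: "prog \<Rightarrow> val \<Rightarrow> val \<Rightarrow> nat \<Rightarrow> bool" where
  Ident: "exec Ident v v 1"
| Const: "exec (Const q) v (VNum (of_rat q)) 1"
| Empty: "exec Empty v VNil 1"
| Head: "exec Head (VCons v w) v 1"
| Tail: "exec Tail (VCons v w) w 1"
| Construct: "exec p u v s \<Longrightarrow> exec q u w t \<Longrightarrow> exec (Construct p q) u (VCons v w) (s + t + 1)"
| Comp: "exec p u v s \<Longrightarrow> exec q v w t \<Longrightarrow> exec (Comp p q) u w (s + t + 1)"
| Add: "exec Add (VCons (VNum x) (VNum y)) (VNum (x + y)) 1"
| Sub: "exec Sub (VCons (VNum x) (VNum y)) (VNum (x - y)) 1"
| Mult: "exec Mult (VCons (VNum x) (VNum y)) (VNum (x * y)) 1"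
| Div: "y \<noteq> 0 \<Longrightarrow> exec Div (VCons (VNum x) (VNum y)) (VNum (x / y)) 1"
| Less: "exec Less (VCons (VNum x) (VNum y)) (if x < y then VCons VNil VNil else VNil) 1"
| CondTrue: "exec p u b r \<Longrightarrow> b \<noteq> VNil \<Longrightarrow> exec q u v s \<Longrightarrow> exec (Cond p q q') u v (r + s + 1)"
| CondFalse: "exec p u VNil r \<Longrightarrow> exec q' u v s \<Longrightarrow> exec (Cond p q q') u v (r + s + 1)"
| WhileTrue: "exec p u b r \<Longrightarrow> b \<noteq> VNil \<Longrightarrow> exec q u v s \<Longrightarrow> exec (While p q) v w t \<Longrightarrow>
    exec (While p q) u w (r + s + t + 1)"
| WhileFalse: "exec p u VNil r \<Longrightarrow> exec (While p q) u u (r + 1)"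

definition poly_time ::
    "'a set \<Rightarrow> ('a \<Rightarrow> nat) \<Rightarrow> ('a \<Rightarrow> val) \<Rightarrow> ('a \<Rightarrow> val) \<Rightarrow> bool" where
  "poly_time X size_of inp outp \<longleftrightarrow>
    (\<exists>p (P :: nat poly). \<forall>x\<in>X. \<exists>t \<le> poly P (size_of x). exec p (inp x) (outp x) t)"

primrec val_of_list :: "val list \<Rightarrow> val" where
  "val_of_list [] = VNil"
| "val_of_list (v # vs) = VCons v (val_of_list vs)"

definition val_of_vec :: "nat \<Rightarrow> (nat \<Rightarrow> real) \<Rightarrow> val" where
  "val_of_vec n x = val_of_list (map (\<lambda>i. VNum (x i)) [0..<n])"

definition val_of_mat :: "nat \<Rightarrow> nat \<Rightarrow> (nat \<Rightarrow> nat \<Rightarrow> real) \<Rightarrow> val" where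
  "val_of_mat n f A = val_of_list (map (\<lambda>i. val_of_vec f (A i)) [0..<n])"


section \<open>Perfect b-matchings and their LP dual\<close>

text \<open>
  A graph with vertex set \<open>{..<n}\<close> is given by the list of its edges; the position in that list is the
  index of the edge in cost vectors, and the orientation of the pairs is irrelevant.
\<close>

type_synonym edges = "(nat \<times> nat) list"

definition bipartite_graph :: "nat \<Rightarrow> edges \<Rightarrow> bool" where
  "bipartite_graph n E \<longleftrightarrow>
    (\<forall>(u, v)\<in>set E. u < n \<and> v < n) \<and>
    distinct (map (\<lambda>(u, v). {u, v}) E) \<and>
    (\<exists>L. \<forall>(u, v)\<in>set E. u \<in> L \<longleftrightarrow> v \<notin> L)"

definition perfect_b_matching :: "nat \<Rightarrow> edges \<Rightarrow> (nat \<Rightarrow> nat) \<Rightarrow> (nat \<Rightarrow> nat) \<Rightarrow> bool" where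
  "perfect_b_matching n E b z \<longleftrightarrow>
    (\<forall>i<n. (\<Sum>e | e < length E \<and> (i = fst (E ! e) \<or> i = snd (E ! e)). z e) = b i)"

definition matching_instance :: "nat \<Rightarrow> edges \<Rightarrow> (nat \<Rightarrow> nat) \<Rightarrow> (nat \<Rightarrow> nat) \<Rightarrow> bool" where
  "matching_instance n E c b \<longleftrightarrow>
    c \<in> {..<length E} \<rightarrow>\<^sub>E UNIV \<and> b \<in> {..<n} \<rightarrow>\<^sub>E UNIV \<and> (\<exists>z. perfect_b_matching n E b z)"

definition dual_feasible :: "edges \<Rightarrow> (nat \<Rightarrow> nat) \<Rightarrow> (nat \<Rightarrow> real) \<Rightarrow> bool" where
  "dual_feasible E c x \<longleftrightarrow> (\<forall>e<length E. x (fst (E ! e)) + x (snd (E ! e)) \<le> real (c e))"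

definition dual_optimal ::
    "nat \<Rightarrow> edges \<Rightarrow> (nat \<Rightarrow> nat) \<Rightarrow> (nat \<Rightarrow> nat) \<Rightarrow> (nat \<Rightarrow> real) \<Rightarrow> bool" where
  "dual_optimal n E c b x \<longleftrightarrow>
    is_arg_max (\<lambda>y. \<Sum>i<n. real (b i) * y i) (dual_feasible E c) x"

definition instance_size :: "nat \<Rightarrow> edges \<Rightarrow> (nat \<Rightarrow> nat) \<Rightarrow> (nat \<Rightarrow> nat) \<Rightarrow> nat" where
  "instance_size n E c b =
    n + length E + (\<Sum>e<length E. floorlog 2 (c e)) + (\<Sum>i<n. floorlog 2 (b i))"

definition val_of_edges :: "edges \<Rightarrow> val" where
  "val_of_edges E = val_of_list (map (\<lambda>(u, v). VCons (VNum (real u)) (VNum (real v))) E)"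

definition val_of_instance :: "nat \<Rightarrow> edges \<Rightarrow> (nat \<Rightarrow> nat) \<Rightarrow> (nat \<Rightarrow> nat) \<Rightarrow> val" where
  "val_of_instance n E c b =
    VCons (VNum (real n)) (VCons (val_of_edges E)
      (VCons (val_of_vec (length E) (\<lambda>e. real (c e))) (val_of_vec n (\<lambda>i. real (b i)))))"

text \<open>
  \<open>xs n E c b\<close> stands for $x^*(c, b)$. A function of this kind is a fixed rule selecting an integral
  optimal dual solution that is computed by a polynomial-time algorithm; the integer data enter the
  input size through their binary lengths.
\<close>

type_synonym dual_rule = "nat \<Rightarrow> edges \<Rightarrow> (nat \<Rightarrow> nat) \<Rightarrow> (nat \<Rightarrow> nat) \<Rightarrow> nat \<Rightarrow> int"

definition poly_time_dual_rule :: "dual_rule \<Rightarrow> bool" where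
  "poly_time_dual_rule xs \<longleftrightarrow>
    (\<forall>n E c b. bipartite_graph n E \<and> matching_instance n E c b \<longrightarrow>
      dual_optimal n E c b (\<lambda>i. real_of_int (xs n E c b i))) \<and>
    poly_time {(n, E, c, b). bipartite_graph n E \<and> matching_instance n E c b}
      (\<lambda>(n, E, c, b). instance_size n E c b)
      (\<lambda>(n, E, c, b). val_of_instance n E c b)
      (\<lambda>(n, E, c, b). val_of_vec n (\<lambda>i. real_of_int (xs n E c b i)))"


section \<open>Samples, losses and the learning problem\<close>

type_synonym sample = "(nat \<Rightarrow> nat) \<times> (nat \<Rightarrow> nat) \<times> (nat \<Rightarrow> real)"
type_synonym matrix = "nat \<Rightarrow> nat \<Rightarrow> real"

definition prob_simplex :: "nat \<Rightarrow> (nat \<Rightarrow> real) set" where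
  "prob_simplex f = {\<phi> \<in> {..<f} \<rightarrow>\<^sub>E {0..}. (\<Sum>j<f. \<phi> j) = 1}"

definition valid_sample :: "nat \<Rightarrow> edges \<Rightarrow> nat \<Rightarrow> real \<Rightarrow> real \<Rightarrow> sample \<Rightarrow> bool" where
  "valid_sample n E f C B = (\<lambda>(c, b, \<phi>).
    matching_instance n E c b \<and> \<phi> \<in> prob_simplex f \<and>
    (\<forall>e<length E. real (c e) \<le> C) \<and> (\<forall>i<n. real (b i) \<le> B))"

definition sample_space :: "nat \<Rightarrow> edges \<Rightarrow> nat \<Rightarrow> sample measure" where
  "sample_space n E f =
    (\<Pi>\<^sub>M e\<in>{..<length E}. count_space UNIV) \<Otimes>\<^sub>M
    (\<Pi>\<^sub>M i\<in>{..<n}. count_space UNIV) \<Otimes>\<^sub>M (\<Pi>\<^sub>M j\<in>{..<f}. borel)"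

definition sample_distribution ::
    "nat \<Rightarrow> edges \<Rightarrow> nat \<Rightarrow> real \<Rightarrow> real \<Rightarrow> sample measure \<Rightarrow> bool" where
  "sample_distribution n E f C B D \<longleftrightarrow>
    prob_space D \<and> sets D = sets (sample_space n E f) \<and> (AE s in D. valid_sample n E f C B s)"

definition seminorm1 :: "nat \<Rightarrow> (nat \<Rightarrow> real) \<Rightarrow> (nat \<Rightarrow> real) \<Rightarrow> real" where
  "seminorm1 n b x = (\<Sum>i<n. b i * \<bar>x i\<bar>)"

definition mat_vec :: "nat \<Rightarrow> matrix \<Rightarrow> (nat \<Rightarrow> real) \<Rightarrow> nat \<Rightarrow> real" where
  "mat_vec f A \<phi> i = (\<Sum>j<f. A i j * \<phi> j)"

definition loss :: "dual_rule \<Rightarrow> nat \<Rightarrow> edges \<Rightarrow> nat \<Rightarrow> sample \<Rightarrow> matrix \<Rightarrow> real" where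
  "loss xs n E f = (\<lambda>(c, b, \<phi>) A.
    seminorm1 n (\<lambda>i. real (b i)) (\<lambda>i. mat_vec f A \<phi> i - real_of_int (xs n E c b i)))"

text \<open>
  If \<open>D\<close> is a \<open>sample_distribution\<close>, only finitely many pairs \<open>(c, b)\<close> have positive probability, so the
  loss is bounded almost everywhere and the Bochner integral is a genuine expectation.
\<close>

definition risk :: "dual_rule \<Rightarrow> nat \<Rightarrow> edges \<Rightarrow> nat \<Rightarrow> sample measure \<Rightarrow> matrix \<Rightarrow> real" where
  "risk xs n E f D A = (\<integral>s. loss xs n E f s A \<partial>D)"

definition max_norm :: "nat \<Rightarrow> nat \<Rightarrow> matrix \<Rightarrow> real" where
  "max_norm n f A = Max ((\<lambda>(i, j). \<bar>A i j\<bar>) ` ({..<n} \<times> {..<f}))"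

text \<open>
  Besides the samples, a learner is told the graph, the feature dimension \<open>f\<close>, the bounds \<open>C\<close> and \<open>B\<close>
  and the accuracy and confidence parameters \<open>\<epsilon>\<close> and \<open>\<delta>\<close>, in this order.
\<close>

type_synonym learner_input =
  "nat \<times> edges \<times> nat \<times> real \<times> real \<times> real \<times> real \<times> sample list"

definition learner_inputs :: "learner_input set" where
  "learner_inputs = {(n, E, f, C, B, \<epsilon>, \<delta>, S).
    bipartite_graph n E \<and> n \<ge> 3 \<and> length E \<ge> 1 \<and> f \<ge> 1 \<and> C \<ge> 0 \<and> B \<ge> 0 \<and> \<epsilon> > 0 \<and> \<delta> > 0 \<and>
    S \<noteq> [] \<and> (\<forall>s\<in>set S. valid_sample n E f C B s)}"

definition learner_input_size :: "learner_input \<Rightarrow> nat" where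
  "learner_input_size = (\<lambda>(n, E, f, C, B, \<epsilon>, \<delta>, S).
    n + length E + f + (\<Sum>(c, b, \<phi>)\<leftarrow>S. instance_size n E c b + f))"

definition val_of_sample :: "nat \<Rightarrow> edges \<Rightarrow> nat \<Rightarrow> sample \<Rightarrow> val" where
  "val_of_sample n E f = (\<lambda>(c, b, \<phi>).
    VCons (val_of_vec (length E) (\<lambda>e. real (c e)))
      (VCons (val_of_vec n (\<lambda>i. real (b i))) (val_of_vec f \<phi>)))"

definition val_of_learner_input :: "learner_input \<Rightarrow> val" where
  "val_of_learner_input = (\<lambda>(n, E, f, C, B, \<epsilon>, \<delta>, S).
    val_of_list [VNum (real n), val_of_edges E, VNum (real f), VNum C, VNum B, VNum \<epsilon>, VNum \<delta>,
      val_of_list (map (val_of_sample n E f) S)])"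

definition poly_time_learner :: "(learner_input \<Rightarrow> matrix) \<Rightarrow> bool" where
  "poly_time_learner learner \<longleftrightarrow>
    poly_time learner_inputs learner_input_size val_of_learner_input
      (\<lambda>x. case x of (n, E, f, _) \<Rightarrow> val_of_mat n f (learner x))"


section \<open>Online subgradient descent\<close>

definition frob_inner :: "nat \<Rightarrow> nat \<Rightarrow> matrix \<Rightarrow> matrix \<Rightarrow> real" where
  "frob_inner n f G A = (\<Sum>i<n. \<Sum>j<f. G i j * A i j)"

text \<open>Subgradients are those of \<open>U\<close> as a function on all matrices, not just on the feasible set.\<close>

definition is_subgradient :: "nat \<Rightarrow> nat \<Rightarrow> (matrix \<Rightarrow> real) \<Rightarrow> matrix \<Rightarrow> matrix \<Rightarrow> bool" where
  "is_subgradient n f U A G \<longleftrightarrow>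
    (\<forall>A'. U A' \<ge> U A + frob_inner n f G (\<lambda>i j. A' i j - A i j))"

definition mat_box :: "nat \<Rightarrow> nat \<Rightarrow> real \<Rightarrow> matrix set" where
  "mat_box n f C = {A. \<forall>i<n. \<forall>j<f. A i j \<in> {- C..C}}"

text \<open>
  \<open>As 0, As 1, \<dots>\<close> are iterates of OGD over \<open>X\<close> with step-size \<open>\<alpha>\<close> on the losses \<open>U 0, \<dots>, U (T - 1)\<close>,
  for some choice of subgradients; rounds are counted from \<open>0\<close>.
\<close>

definition ogd_iterates ::
    "nat \<Rightarrow> nat \<Rightarrow> matrix set \<Rightarrow> real \<Rightarrow> nat \<Rightarrow> (nat \<Rightarrow> matrix \<Rightarrow> real) \<Rightarrow> (nat \<Rightarrow> matrix) \<Rightarrow> bool" where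
  "ogd_iterates n f X \<alpha> T U As \<longleftrightarrow>
    As 0 = (\<lambda>i j. 0) \<and>
    (\<forall>t<T. \<exists>G. is_subgradient n f (U t) (As t) G \<and>
      is_arg_min
        (\<lambda>A. \<alpha> * frob_inner n f G A +
          1/2 * frob_inner n f (\<lambda>i j. A i j - As t i j) (\<lambda>i j. A i j - As t i j))
        (\<lambda>A. A \<in> X) (As (Suc t)))"

definition regret :: "nat \<Rightarrow> (nat \<Rightarrow> matrix \<Rightarrow> real) \<Rightarrow> (nat \<Rightarrow> matrix) \<Rightarrow> matrix \<Rightarrow> real" where
  "regret T U As A = (\<Sum>t<T. U t (As t) - U t A)"

end

theory Submission
  imports Defs
begin

text \<open>
  The learner makes one pass of projected subgradient descent over its samples and returns the average
  of the iterates (online-to-batch conversion). The subgradients and the differences of losses on the box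
  are bounded independently of the size of \<open>x\<^sup>*\<close>, since \<open>x\<^sup>*\<close> cancels in
  \<open>\<bar>(A \<phi>)\<^sub>i - x\<^sup>*\<^sub>i\<bar> - \<bar>(A' \<phi>)\<^sub>i - x\<^sup>*\<^sub>i\<bar>\<close>; hence the regret is at most
  \<open>C\<^sup>2 n f / (2 \<alpha>) + \<alpha> T n B\<^sup>2 / 2\<close>, and the Azuma--Hoeffding inequality controls the difference between the
  regret on the sample and the excess risk. The step-size \<open>\<epsilon> / (2 n B\<^sup>2)\<close> balances the regret without a
  square root, which the machine model does not offer.
\<close>

section \<open>Running times of programs\<close>

text \<open>Polynomial time is a statement about \<open>exec\<close>, so the learner must be
  exhibited as a concrete program with an explicit step count. The dual rule enters it only through
  one call per sample of the program that computes x*.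

  The excess risk \<epsilon> is split in halves. Write R = C B n. The average regret stays below
  \<epsilon>/2 once N \<ge> 4 (R/\<epsilon>)^2 f. The martingale stays below \<epsilon>/2 with
  probability 1 - \<delta> once N \<ge> 32 (R/\<epsilon>)^2 ln (1/\<delta>), because excess losses
  on the box lie in [-2R, 2R]. For f \<ge> 1 the factor f^2 of the statement dominates f, so 32 is
  enough for both, and 64 pays for rounding N down to an integer.

  An iterate is a function of the earlier samples alone. The martingale argument therefore needs no
  filtration or conditional expectation: it integrates the product measure one coordinate at a
  time.\<close>

text \<open>An upper bound on the time instead of the exact time: branches of different cost can
  share one bound, and bounds may be rounded up freely.\<close>

definition runs :: "prog \<Rightarrow> val \<Rightarrow> val \<Rightarrow> nat \<Rightarrow> bool" where
  "runs p u v k \<longleftrightarrow> (\<exists>t\<le>k. exec p u v t)"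

lemma runs_exec: "exec p u v t \<Longrightarrow> runs p u v t"
  by (auto simp: runs_def)

notation Comp (infixr ";>" 60)

lemma runs_Ident: "runs Ident v v 1"
  and runs_Const: "runs (Const q) v (VNum (of_rat q)) 1"
  and runs_Empty: "runs Empty v VNil 1"
  and runs_Head: "runs Head (VCons v w) v 1"
  and runs_Tail: "runs Tail (VCons v w) w 1"
  and runs_Add: "runs Add (VCons (VNum x) (VNum y)) (VNum (x + y)) 1"
  and runs_Sub: "runs Sub (VCons (VNum x) (VNum y)) (VNum (x - y)) 1"
  and runs_Mult: "runs Mult (VCons (VNum x) (VNum y)) (VNum (x * y)) 1"
  by (rule runs_exec, rule exec.intros)+

lemma runs_Div: "y \<noteq> 0 \<Longrightarrow> runs Div (VCons (VNum x) (VNum y)) (VNum (x / y)) 1"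
  by (rule runs_exec, rule exec.Div)

lemma runs_Construct:
  "runs p u v s \<Longrightarrow> runs q u w t \<Longrightarrow> runs (Construct p q) u (VCons v w) (s + t + 1)"
  unfolding runs_def by (meson add_le_mono exec.Construct le_refl)

lemma runs_Comp: "runs p u v s \<Longrightarrow> runs q v w t \<Longrightarrow> runs (p ;> q) u w (s + t + 1)"
  unfolding runs_def by (meson add_le_mono exec.Comp le_refl)

text \<open>Both branches are charged, so one bound serves either outcome and no case distinction
  reaches the callers. Each branch may assume its side of the comparison, which is what makes a
  guarded division executable.\<close>

lemma runs_Cond_Less:
  assumes e: "runs e u (VCons (VNum x) (VNum y)) r"
    and q: "x < y \<Longrightarrow> runs q u v s" and q': "\<not> x < y \<Longrightarrow> runs q' u v' t"
  shows "runs (Cond (e ;> Less) q q') u (if x < y then v else v') (r + s + t + 3)"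
proof -
  obtain r' where r': "r' \<le> r" "exec e u (VCons (VNum x) (VNum y)) r'"
    using e by (auto simp: runs_def)
  have c: "exec (e ;> Less) u (if x < y then VCons VNil VNil else VNil) (r' + 1 + 1)"
    by (rule exec.Comp[OF r'(2) exec.Less])
  show ?thesis
  proof (cases "x < y")
    case True
    with q obtain s' where s': "s' \<le> s" "exec q u v s'" by (auto simp: runs_def)
    have "exec (Cond (e ;> Less) q q') u v (r' + 1 + 1 + s' + 1)"
      using c s'(2) True by (intro CondTrue) auto
    with True r' s' show ?thesis unfolding runs_def by (intro exI[of _ "r' + 1 + 1 + s' + 1"]) auto
  next
    case False
    with q' obtain t' where t': "t' \<le> t" "exec q' u v' t'" by (auto simp: runs_def)
    have "exec (Cond (e ;> Less) q q') u v' (r' + 1 + 1 + t' + 1)"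
      using c t'(2) False by (intro CondFalse) auto
    with False r' t' show ?thesis unfolding runs_def by (intro exI[of _ "r' + 1 + 1 + t' + 1"]) auto
  qed
qed

text \<open>The equation \<open>v = w\<close> lets output and cost be synthesised by unification
  from the rules in \<open>runs_basic\<close>; what remains is an identity of values and a numerical
  inequality.\<close>

lemma runs_weaken: "runs p u v k \<Longrightarrow> v = w \<Longrightarrow> k \<le> l \<Longrightarrow> runs p u w l"
  unfolding runs_def by (meson le_trans)

lemma runs_zero: "runs (Const 0) v (VNum 0) 1"
  and runs_one: "runs (Const 1) v (VNum 1) 1"
  and runs_two: "runs (Const 2) v (VNum 2) 1"
  using runs_Const[of 0] runs_Const[of 1] runs_Const[of 2] by simp_all

lemmas runs_basic =
  runs_Ident runs_Empty runs_Head runs_Tail runs_Add runs_Sub runs_Mult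
  runs_zero runs_one runs_two
  runs_Construct runs_Comp

section \<open>Loops over lists\<close>

abbreviation vals :: "nat \<Rightarrow> nat \<Rightarrow> (nat \<Rightarrow> val) \<Rightarrow> val" where
  "vals m n X \<equiv> val_of_list (map X [m..<n])"

lemma vals_Cons: "k < n \<Longrightarrow> vals k n X = VCons (X k) (vals (Suc k) n X)"
  by (simp add: upt_conv_Cons)

text \<open>Induction from the end of the list backwards. \<open>Head\<close> serves as loop test
  because the state starts with the unread suffix, and an empty suffix is \<open>VNil\<close>, which
  reads as false. Beyond the body, a round costs 6 steps: 1 for the test, 3 for
  \<open>Head ;> Tail\<close>, 1 for \<open>Construct\<close>, 1 for \<open>While\<close>.\<close>

lemma runs_list_loop:
  assumes "\<And>k. k < n \<Longrightarrow> runs q (VCons (vals k n X) (F k)) (F (Suc k)) T"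
  shows "runs (While Head (Construct (Head ;> Tail) q)) (VCons (vals 0 n X) (F 0))
    (VCons VNil (F n)) (n * (T + 6) + 2)"
proof -
  let ?W = "While Head (Construct (Head ;> Tail) q)"
  have "runs ?W (VCons (vals k n X) (F k)) (VCons VNil (F n)) ((n - k) * (T + 6) + 2)"
    if "k \<le> n" for k
    using that
  proof (induction k rule: inc_induct)
    case base
    have "exec ?W (VCons VNil (F n)) (VCons VNil (F n)) (1 + 1)"
      by (intro WhileFalse exec.Head)
    then show ?case unfolding runs_def by (intro exI[of _ "1 + 1"]) auto
  next
    case (step k)
    obtain t where t: "t \<le> T" "exec q (VCons (vals k n X) (F k)) (F (Suc k)) t"
      using assms step by (auto simp: runs_def)
    obtain s where s: "s \<le> (n - Suc k) * (T + 6) + 2"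
      "exec ?W (VCons (vals (Suc k) n X) (F (Suc k))) (VCons VNil (F n)) s"
      using step by (auto simp: runs_def)
    note k = vals_Cons[OF step(2), of X]
    have "exec ?W (VCons (vals k n X) (F k)) (VCons VNil (F n)) (1 + ((1 + 1 + 1) + t + 1) + s + 1)"
    proof (rule WhileTrue)
      show "exec Head (VCons (vals k n X) (F k)) (vals k n X) 1" by (rule exec.Head)
      show "vals k n X \<noteq> VNil" unfolding k by simp
      show "exec (Construct (Head ;> Tail) q) (VCons (vals k n X) (F k))
          (VCons (vals (Suc k) n X) (F (Suc k))) ((1 + 1 + 1) + t + 1)"
        by (rule exec.Construct[OF _ t(2)], unfold k, rule exec.Comp[OF exec.Head exec.Tail])
    qed fact
    moreover have "(n - k) * (T + 6) + 2 = (T + 6) + ((n - Suc k) * (T + 6) + 2)"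
      using step(2) by (simp flip: Suc_diff_Suc)
    ultimately show ?case unfolding runs_def
      using s(1) t(1) by (intro exI[of _ "1 + ((1 + 1 + 1) + t + 1) + s + 1"]) auto
  qed
  from this[of 0] show ?thesis by simp
qed

definition reverse_prog :: prog where
  "reverse_prog = Construct Ident Empty ;>
     While Head (Construct (Head ;> Tail) (Construct (Head ;> Head) Tail)) ;> Tail"

lemma runs_reverse: "runs reverse_prog (val_of_list xs) (val_of_list (rev xs)) (length xs * 11 + 8)"
proof -
  define n X where "n = length xs" and "X = nth xs"
  have xs: "xs = map X [0..<n]" by (simp add: n_def X_def map_nth)
  have loop: "runs (While Head (Construct (Head ;> Tail) (Construct (Head ;> Head) Tail)))
     (VCons (vals 0 n X) (val_of_list (rev (map X [0..<0]))))
     (VCons VNil (val_of_list (rev (map X [0..<n])))) (n * (5 + 6) + 2)"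
  proof (rule runs_list_loop)
    fix k assume "k < n"
    then show "runs (Construct (Head ;> Head) Tail)
        (VCons (vals k n X) (val_of_list (rev (map X [0..<k]))))
        (val_of_list (rev (map X [0..<Suc k]))) 5"
      by (subst vals_Cons, assumption) (rule runs_weaken, (rule runs_basic)+, auto)
  qed
  show ?thesis unfolding reverse_prog_def xs
    by (rule runs_weaken,
      (rule runs_basic loop[unfolded upt_0 list.map rev.simps val_of_list.simps])+, auto)
qed

text \<open>The loop state is (rest of X, (rest of Y, (environment, results))). Results are consed
  and so appear backwards, whence the final reversal. The environment carries parameters common to
  all positions; passing the same list twice gives an ordinary map.\<close>

definition map2_prog :: "prog \<Rightarrow> prog" where
  "map2_prog q = Construct Head (Construct (Tail ;> Head) (Construct (Tail ;> Tail) Empty)) ;>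
     While Head (Construct (Head ;> Tail)
       (Construct (Tail ;> Head ;> Tail) (Construct (Tail ;> Tail ;> Head)
         (Construct (Construct (Head ;> Head) (Construct (Tail ;> Head ;> Head) (Tail ;> Tail ;> Head)) ;> q)
           (Tail ;> Tail ;> Tail))))) ;>
     Tail ;> Tail ;> Tail ;> reverse_prog"

lemma runs_map2:
  assumes "\<And>k. k < n \<Longrightarrow> runs q (VCons (X k) (VCons (Y k) env)) (Z k) T"
  shows "runs (map2_prog q) (VCons (vals 0 n X) (VCons (vals 0 n Y) env)) (vals 0 n Z)
    (n * (T + 60) + 40)"
proof -
  let ?q = "Construct (Tail ;> Head ;> Tail) (Construct (Tail ;> Tail ;> Head)
         (Construct (Construct (Head ;> Head) (Construct (Tail ;> Head ;> Head) (Tail ;> Tail ;> Head)) ;> q)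
           (Tail ;> Tail ;> Tail)))"
  let ?F = "\<lambda>k. VCons (vals k n Y) (VCons env (val_of_list (rev (map Z [0..<k]))))"
  have loop: "runs (While Head (Construct (Head ;> Tail) ?q))
     (VCons (vals 0 n X) (?F 0)) (VCons VNil (?F n)) (n * ((T + 40) + 6) + 2)"
  proof (rule runs_list_loop)
    fix k assume "k < n"
    then show "runs ?q (VCons (vals k n X) (?F k)) (?F (Suc k)) (T + 40)"
      unfolding vals_Cons[OF \<open>k < n\<close>]
      by - (rule runs_weaken, (rule runs_basic assms[OF \<open>k < n\<close>])+, auto)
  qed
  show ?thesis unfolding map2_prog_def
    by (rule runs_weaken, (rule runs_basic runs_reverse
      loop[unfolded upt_0 list.map rev.simps val_of_list.simps])+, auto simp: algebra_simps)
qed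

definition dot_prog :: prog where
  "dot_prog = Construct Head (Construct Tail (Const 0)) ;>
     While Head (Construct (Head ;> Tail)
       (Construct (Tail ;> Head ;> Tail)
         (Construct (Tail ;> Tail) (Construct (Head ;> Head) (Tail ;> Head ;> Head) ;> Mult) ;> Add))) ;>
     Tail ;> Tail"

lemma runs_dot:
  "runs dot_prog (VCons (vals 0 n (\<lambda>j. VNum (X j))) (vals 0 n (\<lambda>j. VNum (Y j))))
    (VNum (\<Sum>j<n. X j * Y j)) (n * 40 + 40)"
proof -
  let ?q = "Construct (Tail ;> Head ;> Tail)
         (Construct (Tail ;> Tail) (Construct (Head ;> Head) (Tail ;> Head ;> Head) ;> Mult) ;> Add)"
  let ?F = "\<lambda>k. VCons (vals k n (\<lambda>j. VNum (Y j))) (VNum (\<Sum>j<k. X j * Y j))"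
  have loop: "runs (While Head (Construct (Head ;> Tail) ?q))
     (VCons (vals 0 n (\<lambda>j. VNum (X j))) (?F 0)) (VCons VNil (?F n)) (n * (34 + 6) + 2)"
  proof (rule runs_list_loop)
    fix k assume "k < n"
    then show "runs ?q (VCons (vals k n (\<lambda>j. VNum (X j))) (?F k)) (?F (Suc k)) 34"
      unfolding vals_Cons[OF \<open>k < n\<close>]
      by - (rule runs_weaken, (rule runs_basic)+, auto)
  qed
  show ?thesis unfolding dot_prog_def
    by (rule runs_weaken, (rule runs_basic loop[unfolded lessThan_0 sum.empty])+, auto)
qed


section \<open>The learning algorithm\<close>

text \<open>For C \<ge> 0, the Euclidean projection onto [-C, C]. The box is a product of intervals,
  so its projection acts entry by entry.\<close>

definition clip :: "real \<Rightarrow> real \<Rightarrow> real" where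
  "clip C y = (if y < - C then - C else if C < y then C else y)"

text \<open>The sign of the residual times b_i \<phi>_j. A zero residual counts as positive, so a
  single comparison decides the sign.\<close>

definition loss_subgradient :: "dual_rule \<Rightarrow> nat \<Rightarrow> edges \<Rightarrow> nat \<Rightarrow> sample \<Rightarrow> matrix \<Rightarrow> matrix" where
  "loss_subgradient xs n E f = (\<lambda>(c, b, \<phi>) A i j.
     (if mat_vec f A \<phi> i < real_of_int (xs n E c b i) then - real (b i) else real (b i)) * \<phi> j)"

primrec ogd_seq ::
    "dual_rule \<Rightarrow> nat \<Rightarrow> edges \<Rightarrow> nat \<Rightarrow> real \<Rightarrow> real \<Rightarrow> (nat \<Rightarrow> sample) \<Rightarrow> nat \<Rightarrow> matrix" where
  "ogd_seq xs n E f C \<alpha> S 0 = (\<lambda>i j. 0)"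
| "ogd_seq xs n E f C \<alpha> S (Suc t) = (\<lambda>i j.
     clip C (ogd_seq xs n E f C \<alpha> S t i j -
       \<alpha> * loss_subgradient xs n E f (S t) (ogd_seq xs n E f C \<alpha> S t) i j))"

definition ogd_average ::
    "dual_rule \<Rightarrow> nat \<Rightarrow> edges \<Rightarrow> nat \<Rightarrow> real \<Rightarrow> real \<Rightarrow> (nat \<Rightarrow> sample) \<Rightarrow> nat \<Rightarrow> matrix" where
  "ogd_average xs n E f C \<alpha> S T = (\<lambda>i j. (\<Sum>t<T. ogd_seq xs n E f C \<alpha> S t i j) / real T)"

text \<open>With squared gradient norms at most n B^2, this step-size makes the gradient term
  \<alpha> n B^2 / 2 of the regret equal to \<epsilon>/4 per round; a large enough sample then
  brings the remaining term below \<epsilon>/4 per round.\<close>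

definition ogd_learner :: "dual_rule \<Rightarrow> learner_input \<Rightarrow> matrix" where
  "ogd_learner xs = (\<lambda>(n, E, f, C, B, \<epsilon>, \<delta>, S).
     ogd_average xs n E f C (\<epsilon> / (2 * real n * B\<^sup>2)) (nth S) (length S))"

section \<open>The learner as a program\<close>

definition clip_prog :: prog where
  "clip_prog =
     Cond (Construct Head (Construct (Const 0) Tail ;> Sub) ;> Less) (Construct (Const 0) Tail ;> Sub)
       (Cond (Construct Tail Head ;> Less) Tail Head)"

lemma runs_clip: "runs clip_prog (VCons (VNum y) (VNum C)) (VNum (clip C y)) 40"
  unfolding clip_prog_def
  by (rule runs_weaken, (rule runs_Cond_Less runs_basic)+, auto simp: clip_def)

text \<open>The input is (row of A, ((b_i, x*_i), (\<phi>, (C, \<alpha>)))). The comparison yields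
  the signed scalar g = \<alpha> b_i or -\<alpha> b_i once per row; then every entry becomes the
  clipped value of a_j - g \<phi>_j.\<close>

definition row_prog :: prog where
  "row_prog = Construct Head (Construct (Tail ;> Tail ;> Head) (Construct (Tail ;> Tail ;> Tail ;> Head)
     (Cond (Construct (Construct Head (Tail ;> Tail ;> Head) ;> dot_prog) (Tail ;> Head ;> Tail) ;> Less)
       (Construct (Const 0) (Construct (Tail ;> Tail ;> Tail ;> Tail) (Tail ;> Head ;> Head) ;> Mult) ;> Sub)
       (Construct (Tail ;> Tail ;> Tail ;> Tail) (Tail ;> Head ;> Head) ;> Mult)))) ;>
     map2_prog (Construct
       (Construct Head (Construct (Tail ;> Tail ;> Tail) (Tail ;> Head) ;> Mult) ;> Sub)
       (Tail ;> Tail ;> Head) ;> clip_prog)"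

lemma runs_row:
  "runs row_prog
    (VCons (vals 0 f (\<lambda>j. VNum (a j))) (VCons (VCons (VNum b) (VNum x))
      (VCons (vals 0 f (\<lambda>j. VNum (\<phi> j))) (VCons (VNum C) (VNum \<alpha>)))))
    (vals 0 f (\<lambda>j. VNum (clip C (a j - \<alpha> * ((if (\<Sum>j<f. a j * \<phi> j) < x then - b else b) * \<phi> j)))))
    (f * 200 + 200)"
proof -
  let ?q = "Construct (Construct Head (Construct (Tail ;> Tail ;> Tail) (Tail ;> Head) ;> Mult) ;> Sub)
       (Tail ;> Tail ;> Head) ;> clip_prog"
  have q: "runs ?q (VCons (VNum (a k)) (VCons (VNum (\<phi> k)) (VCons (VNum C) (VNum g))))
    (VNum (clip C (a k - g * \<phi> k))) 80" for k g
    by (rule runs_weaken, (rule runs_clip runs_basic)+, auto)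
  \<comment> \<open>The conditional delivers its value as an \<open>if\<close> term; stating the
    rule for an arbitrary truth value \<open>\<beta>\<close> allows unification with it.\<close>
  have m: "runs (map2_prog ?q) (VCons (vals 0 f (\<lambda>j. VNum (a j)))
      (VCons (vals 0 f (\<lambda>j. VNum (\<phi> j))) (VCons (VNum C) (if \<beta> then VNum g else VNum h))))
    (vals 0 f (\<lambda>j. VNum (clip C (a j - (if \<beta> then g else h) * \<phi> j)))) (f * (80 + 60) + 40)" for g h \<beta>
    by (cases \<beta>; simp only: if_True if_False; rule runs_map2, rule q)
  show ?thesis unfolding row_prog_def
    by (rule runs_weaken, (rule m runs_dot runs_Cond_Less runs_basic)+,
      auto simp: algebra_simps)
qed

text \<open>The input \<open>p\<close> computes x* from the instance reassembled out of the sample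
  and the constants in the state. The running sum receives the iterate from before the update, so
  after t rounds it holds the iterates 0, ..., t - 1.\<close>

definition step_prog :: "prog \<Rightarrow> prog" where
  "step_prog p =
    Construct
      (Construct (Tail ;> Head)
        (Construct
          (Construct (Head ;> Head ;> Tail ;> Head)
            (Construct
              (Construct (Tail ;> Tail ;> Tail ;> Tail ;> Head)
                (Construct (Tail ;> Tail ;> Tail ;> Tail ;> Tail ;> Head)
                  (Construct (Head ;> Head ;> Head) (Head ;> Head ;> Tail ;> Head))) ;> p)
              Empty) ;> map2_prog (Construct Head (Tail ;> Head)))
          (Construct (Head ;> Head ;> Tail ;> Tail) (Tail ;> Tail ;> Tail ;> Tail ;> Tail ;> Tail))) ;>
        map2_prog row_prog)
      (Construct
        (Construct (Tail ;> Tail ;> Head) (Construct (Tail ;> Head) Empty) ;>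
          map2_prog (Construct Head (Construct (Tail ;> Head) Empty) ;>
            map2_prog (Construct Head (Tail ;> Head) ;> Add)))
        (Construct (Construct (Tail ;> Tail ;> Tail ;> Head) (Const 1) ;> Add)
          (Tail ;> Tail ;> Tail ;> Tail)))"

text \<open>Current iterate, sum of the earlier iterates, round counter, then data that never
  change. The counter ends as the number of samples, the divisor of the average.\<close>

abbreviation state ::
    "nat \<Rightarrow> edges \<Rightarrow> nat \<Rightarrow> real \<Rightarrow> real \<Rightarrow> matrix \<Rightarrow> matrix \<Rightarrow> nat \<Rightarrow> val" where
  "state n E f C \<alpha> A M t \<equiv> VCons (val_of_mat n f A) (VCons (val_of_mat n f M)
     (VCons (VNum (real t)) (VCons (VNum (real n)) (VCons (val_of_edges E) (VCons (VNum C) (VNum \<alpha>))))))"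

lemma runs_step:
  assumes p: "runs p (val_of_instance n E c b) (val_of_vec n (\<lambda>i. real_of_int (xs n E c b i))) R"
  shows "runs (step_prog p) (VCons (VCons (val_of_sample n E f (c, b, \<phi>)) rest) (state n E f C \<alpha> A M t))
    (state n E f C \<alpha> (\<lambda>i j. clip C (A i j - \<alpha> * loss_subgradient xs n E f (c, b, \<phi>) A i j))
      (\<lambda>i j. M i j + A i j) (Suc t)) (R + n * (f * 500 + 500) + 500)"
proof -
  have bx: "runs (map2_prog (Construct Head (Tail ;> Head)))
    (VCons (vals 0 n (\<lambda>i. VNum (real (b i)))) (VCons (vals 0 n (\<lambda>i. VNum (real_of_int (xs n E c b i)))) VNil))
    (vals 0 n (\<lambda>i. VCons (VNum (real (b i))) (VNum (real_of_int (xs n E c b i))))) (n * (5 + 60) + 40)"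
    by (rule runs_map2, rule runs_weaken, (rule runs_basic)+, auto)
  note rows = runs_map2[where n = n, OF runs_row]
  have sum: "runs (map2_prog (Construct Head (Construct (Tail ;> Head) Empty) ;>
            map2_prog (Construct Head (Tail ;> Head) ;> Add)))
     (VCons (vals 0 n (\<lambda>i. vals 0 f (\<lambda>j. VNum (M i j)))) (VCons (vals 0 n (\<lambda>i. vals 0 f (\<lambda>j. VNum (A i j)))) VNil))
     (vals 0 n (\<lambda>i. vals 0 f (\<lambda>j. VNum (M i j + A i j)))) (n * ((f * (10 + 60) + 50) + 60) + 40)"
  proof (rule runs_map2)
    fix k
    have "runs (map2_prog (Construct Head (Tail ;> Head) ;> Add))
     (VCons (vals 0 f (\<lambda>j. VNum (M k j))) (VCons (vals 0 f (\<lambda>j. VNum (A k j))) VNil))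
     (vals 0 f (\<lambda>j. VNum (M k j + A k j))) (f * (10 + 60) + 40)"
      by (rule runs_map2, rule runs_weaken, (rule runs_basic)+, auto)
    note m = this
    show "runs (Construct Head (Construct (Tail ;> Head) Empty) ;>
            map2_prog (Construct Head (Tail ;> Head) ;> Add))
     (VCons (vals 0 f (\<lambda>j. VNum (M k j))) (VCons (vals 0 f (\<lambda>j. VNum (A k j))) VNil))
     (vals 0 f (\<lambda>j. VNum (M k j + A k j))) (f * (10 + 60) + 50)"
      by (rule runs_weaken, (rule runs_basic m)+, auto)
  qed
  note p' = p[unfolded val_of_instance_def val_of_vec_def]
  show ?thesis
    unfolding step_prog_def val_of_mat_def val_of_vec_def val_of_sample_def prod.case
    by (rule runs_weaken, (rule bx sum rows p' runs_basic)+,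
      auto simp: loss_subgradient_def mat_vec_def algebra_simps)
qed

text \<open>The demand and feature lists of a sample, located by \<open>s\<close>, serve as
  templates of lengths n and f, so that no counting loop is required. This is where the sample must
  be nonempty.\<close>

definition zero_prog :: "prog \<Rightarrow> prog" where
  "zero_prog s = Construct (s ;> Tail ;> Head) (Construct (s ;> Tail ;> Head)
     (Construct (s ;> Tail ;> Tail) (Construct (s ;> Tail ;> Tail) Empty) ;> map2_prog (Const 0))) ;>
     map2_prog (Tail ;> Tail)"

lemma runs_zero_mat:
  assumes s: "runs s u (val_of_sample n E f (c, b, \<phi>)) T"
  shows "runs (zero_prog s) u (val_of_mat n f (\<lambda>i j. 0)) (4 * T + n * 100 + f * 100 + 200)"
proof -
  have row: "runs (map2_prog (Const 0)) (VCons (vals 0 f (\<lambda>j. VNum (\<phi> j)))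
      (VCons (vals 0 f (\<lambda>j. VNum (\<phi> j))) VNil))
    (vals 0 f (\<lambda>j. VNum 0)) (f * (1 + 60) + 40)"
    by (rule runs_map2, rule runs_zero)
  have mat: "runs (map2_prog (Tail ;> Tail)) (VCons (vals 0 n (\<lambda>i. VNum (real (b i))))
      (VCons (vals 0 n (\<lambda>i. VNum (real (b i)))) v)) (vals 0 n (\<lambda>i. v)) (n * (5 + 60) + 40)" for v
    by (rule runs_map2, rule runs_weaken, (rule runs_basic)+, auto)
  show ?thesis unfolding zero_prog_def val_of_mat_def val_of_vec_def
    by (rule runs_weaken,
      (rule row mat s[unfolded val_of_sample_def prod.case val_of_vec_def] runs_basic)+,
      auto simp: algebra_simps)
qed

text \<open>The guard covers B = 0, where \<open>Div\<close> has no execution while division in HOL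
  returns 0; both conventions then agree.\<close>

definition alpha_prog :: prog where
  "alpha_prog =
     Cond (Construct (Const 0) (Tail ;> Tail ;> Tail ;> Tail ;> Head) ;> Less)
       (Construct (Tail ;> Tail ;> Tail ;> Tail ;> Tail ;> Head)
         (Construct (Construct (Const 2) Head ;> Mult)
           (Construct (Tail ;> Tail ;> Tail ;> Tail ;> Head) (Tail ;> Tail ;> Tail ;> Tail ;> Head) ;> Mult) ;>
           Mult) ;> Div)
       (Const 0)"

lemma runs_alpha:
  assumes "n > 0" "B \<ge> 0"
  shows "runs alpha_prog
    (VCons (VNum (real n)) (VCons v1 (VCons v2 (VCons v3 (VCons (VNum B) (VCons (VNum \<epsilon>) v4))))))
    (VNum (\<epsilon> / (2 * real n * B\<^sup>2))) 100"
proof -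
  have d: "0 < B \<Longrightarrow> runs Div (VCons (VNum \<epsilon>) (VNum (2 * real n * (B * B)))) (VNum (\<epsilon> / (2 * real n * (B * B)))) 1"
    using assms by (intro runs_Div) auto
  show ?thesis unfolding alpha_prog_def
    by (rule runs_weaken, (rule d runs_Cond_Less runs_basic | assumption)+,
      use assms in \<open>auto simp: power2_eq_square\<close>)
qed

definition average_prog :: prog where
  "average_prog = map2_prog (Construct Head (Construct Head (Tail ;> Tail)) ;>
     map2_prog (Construct Head (Tail ;> Tail) ;> Div))"

lemma runs_average:
  assumes "N > 0"
  shows "runs average_prog (VCons (val_of_mat n f M) (VCons (val_of_mat n f M) (VNum (real N))))
    (val_of_mat n f (\<lambda>i j. M i j / real N)) (n * (f * 100 + 200) + 40)"
proof -
  have d: "runs Div (VCons (VNum x) (VNum (real N))) (VNum (x / real N)) 1" for x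
    using assms by (intro runs_Div) auto
  have row: "runs (map2_prog (Construct Head (Tail ;> Tail) ;> Div))
      (VCons (vals 0 f (\<lambda>j. VNum (M k j))) (VCons (vals 0 f (\<lambda>j. VNum (M k j))) (VNum (real N))))
      (vals 0 f (\<lambda>j. VNum (M k j / real N))) (f * (10 + 60) + 40)" for k
    by (rule runs_map2, rule runs_weaken, (rule d runs_basic)+, auto)
  have "runs average_prog (VCons (val_of_mat n f M) (VCons (val_of_mat n f M) (VNum (real N))))
    (val_of_mat n f (\<lambda>i j. M i j / real N)) (n * ((f * 70 + 60) + 60) + 40)"
    unfolding average_prog_def val_of_mat_def val_of_vec_def
    by (rule runs_map2, rule runs_weaken, (rule row runs_basic)+, auto)
  then show ?thesis by (rule runs_weaken) (auto simp: algebra_simps)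
qed

definition learner_prog :: "prog \<Rightarrow> prog" where
  "learner_prog p =
     Construct (Tail ;> Tail ;> Tail ;> Tail ;> Tail ;> Tail ;> Tail ;> Head)
       (Construct (zero_prog (Tail ;> Tail ;> Tail ;> Tail ;> Tail ;> Tail ;> Tail ;> Head ;> Head))
         (Construct (zero_prog (Tail ;> Tail ;> Tail ;> Tail ;> Tail ;> Tail ;> Tail ;> Head ;> Head))
           (Construct (Const 0) (Construct Head (Construct (Tail ;> Head)
             (Construct (Tail ;> Tail ;> Tail ;> Head) alpha_prog)))))) ;>
     While Head (Construct (Head ;> Tail) (step_prog p)) ;>
     Construct (Tail ;> Tail ;> Head) (Construct (Tail ;> Tail ;> Head) (Tail ;> Tail ;> Tail ;> Head)) ;>
     average_prog"

lemma runs_learner: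
  assumes S: "S \<noteq> []" and n: "n > 0" and B: "B \<ge> 0"
    and p: "\<And>c b \<phi>. (c, b, \<phi>) \<in> set S \<Longrightarrow>
      runs p (val_of_instance n E c b) (val_of_vec n (\<lambda>i. real_of_int (xs n E c b i))) R"
  shows "runs (learner_prog p) (val_of_learner_input (n, E, f, C, B, \<epsilon>, \<delta>, S))
    (val_of_mat n f (ogd_learner xs (n, E, f, C, B, \<epsilon>, \<delta>, S)))
    (length S * (R + n * (f * 500 + 500) + 600) + n * (f * 500 + 500) + f * 500 + 2000)"
proof -
  define N where "N = length S"
  define \<alpha> where "\<alpha> = \<epsilon> / (2 * real n * B\<^sup>2)"
  define Q where "Q = ogd_seq xs n E f C \<alpha> (nth S)"
  have N: "N > 0" using S by (simp add: N_def)
  let ?X = "\<lambda>k. val_of_sample n E f (S ! k)"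
  have XS: "val_of_list (map (val_of_sample n E f) S) = vals 0 N ?X"
    by (intro arg_cong[of _ _ val_of_list] nth_equalityI) (auto simp: N_def)
  obtain c b \<phi> where s0: "S ! 0 = (c, b, \<phi>)" by (metis surj_pair)
  \<comment> \<open>Loop invariant: before round t the machine holds iterate t and the sum of all
    earlier ones.\<close>
  let ?F = "\<lambda>t. state n E f C \<alpha> (Q t) (\<lambda>i j. \<Sum>s<t. Q s i j) t"
  have loop: "runs (While Head (Construct (Head ;> Tail) (step_prog p)))
     (VCons (vals 0 N ?X) (?F 0)) (VCons VNil (?F N)) (N * ((R + n * (f * 500 + 500) + 500) + 6) + 2)"
  proof (rule runs_list_loop)
    fix k assume k: "k < N"
    obtain c b \<phi> where s: "S ! k = (c, b, \<phi>)" by (metis surj_pair)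
    have "(c, b, \<phi>) \<in> set S" using s k by (metis N_def nth_mem)
    note step = runs_step[where xs = xs and n = n and E = E, OF p[OF this]]
    from step[where f = f and \<phi> = \<phi> and rest = "vals (Suc k) N ?X" and C = C and \<alpha> = \<alpha>
      and A = "Q k" and M = "\<lambda>i j. \<Sum>s<k. Q s i j" and t = k]
    show "runs (step_prog p) (VCons (vals k N ?X) (?F k)) (?F (Suc k)) (R + n * (f * 500 + 500) + 500)"
      unfolding vals_Cons[OF k] s by (simp add: Q_def s)
  qed
  have Q0: "Q 0 = (\<lambda>i j. 0)" by (simp add: Q_def)
  \<comment> \<open>The first list cell is exposed because the zero matrices are built from the
    first sample.\<close>
  note loop' = loop[unfolded vals_Cons[OF N] s0 Q0 lessThan_0 sum.empty of_nat_0]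
  have out: "ogd_learner xs (n, E, f, C, B, \<epsilon>, \<delta>, S) = (\<lambda>i j. (\<Sum>s<N. Q s i j) / real N)"
    by (simp add: ogd_learner_def ogd_average_def Q_def \<alpha>_def N_def)
  show ?thesis
    unfolding learner_prog_def val_of_learner_input_def prod.case val_of_list.simps XS out
      vals_Cons[OF N] s0 N_def[symmetric]
    by (rule runs_weaken, (rule loop' runs_zero_mat runs_average[OF N] runs_alpha[OF n B, where \<epsilon> = \<epsilon>, folded \<alpha>_def]
      runs_basic)+, auto simp: algebra_simps)
qed

lemma poly_nat_mono: "x \<le> y \<Longrightarrow> poly (P :: nat poly) x \<le> poly P y"
  by (induction P) (auto intro!: add_mono mult_mono)

theorem poly_time_ogd_learner:
  assumes "poly_time_dual_rule xs"
  shows "poly_time_learner (ogd_learner xs)"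
proof -
  obtain p P where pP0: "\<forall>x\<in>{(n, E, c, b). bipartite_graph n E \<and> matching_instance n E c b}.
      \<exists>t \<le> poly P ((\<lambda>(n, E, c, b). instance_size n E c b) x).
        exec p ((\<lambda>(n, E, c, b). val_of_instance n E c b) x)
          ((\<lambda>(n, E, c, b). val_of_vec n (\<lambda>i. real_of_int (xs n E c b i))) x) t"
    using assms unfolding poly_time_dual_rule_def poly_time_def by (elim conjE exE)
  have pP: "\<exists>t \<le> poly P (instance_size n E c b).
        exec p (val_of_instance n E c b) (val_of_vec n (\<lambda>i. real_of_int (xs n E c b i))) t"
    if "bipartite_graph n E" "matching_instance n E c b" for n E c b
    using bspec[OF pP0, of "(n, E, c, b)"] that by simp
  define X where "X = [:0, 1 :: nat:]"
  define K where "K c = [:c :: nat:]" for c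
  \<comment> \<open>The bound of \<open>runs_learner\<close> with n, f and the number of samples
    replaced by the input size L, and \<open>R\<close> by the polynomial of the dual rule.\<close>
  define Q where "Q = X * (P + X * (X * K 500 + K 500) + K 600) + X * (X * K 500 + K 500) + X * K 500 + K 2000"
  have Q: "poly Q L = L * (poly P L + L * (L * 500 + 500) + 600) + L * (L * 500 + 500) + L * 500 + 2000" for L
  proof -
    have [simp]: "poly X L = L" "poly (K c) L = c" for c by (simp_all add: X_def K_def)
    show ?thesis by (simp only: Q_def poly_add poly_mult \<open>poly X L = L\<close> \<open>\<And>c. poly (K c) L = c\<close>)
  qed
  have "\<exists>t \<le> poly Q (learner_input_size x).
      exec (learner_prog p) (val_of_learner_input x)
        (case x of (n, E, f, _) \<Rightarrow> val_of_mat n f (ogd_learner xs x)) t"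
    if x: "x \<in> learner_inputs" for x
  proof -
    obtain n E f C B \<epsilon> \<delta> S where xeq: "x = (n, E, f, C, B, \<epsilon>, \<delta>, S)" by (metis surj_pair)
    define L where "L = learner_input_size x"
    have *: "bipartite_graph n E" "n \<ge> 3" "length E \<ge> 1" "B \<ge> 0" "S \<noteq> []"
      "\<And>s. s \<in> set S \<Longrightarrow> valid_sample n E f C B s"
      using x by (auto simp: learner_inputs_def xeq)
    have L: "L = n + length E + f + (\<Sum>(c, b, \<phi>)\<leftarrow>S. instance_size n E c b + f)"
      by (simp add: L_def learner_input_size_def xeq)
    have "n \<le> L" "f \<le> L" by (simp_all add: L)
    \<comment> \<open>Each sample adds at least n \<ge> 3 to the input size, so the number of rounds
      is at most L.\<close>
    have "length S = (\<Sum>(c, b, \<phi>)\<leftarrow>S. 1)" by (simp add: sum_list_triv split_def)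
    also have "\<dots> \<le> (\<Sum>(c, b, \<phi>)\<leftarrow>S. instance_size n E c b + f)"
      using *(2) by (intro sum_list_mono) (auto simp: instance_size_def)
    finally have S: "length S \<le> L" by (simp add: L)
    have "runs p (val_of_instance n E c b) (val_of_vec n (\<lambda>i. real_of_int (xs n E c b i))) (poly P L)"
      if s: "(c, b, \<phi>) \<in> set S" for c b \<phi>
    proof -
      have "instance_size n E c b + f \<le> (\<Sum>(c, b, \<phi>)\<leftarrow>S. instance_size n E c b + f)"
        using s by (intro member_le_sum_list) (force | simp)+
      then have "poly P (instance_size n E c b) \<le> poly P L"
        by (intro poly_nat_mono) (simp add: L)
      moreover have "matching_instance n E c b" using *(6)[OF s] by (simp add: valid_sample_def)
      ultimately show ?thesis using pP[OF *(1)] unfolding runs_def by (meson le_trans)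
    qed
    note run = this
    from * have "runs (learner_prog p) (val_of_learner_input x) (val_of_mat n f (ogd_learner xs x))
      (length S * (poly P L + n * (f * 500 + 500) + 600) + n * (f * 500 + 500) + f * 500 + 2000)"
      unfolding xeq by (intro runs_learner run) auto
    moreover have "length S * (poly P L + n * (f * 500 + 500) + 600) + n * (f * 500 + 500) + f * 500 + 2000
      \<le> L * (poly P L + L * (L * 500 + 500) + 600) + L * (L * 500 + 500) + L * 500 + 2000"
      using S \<open>n \<le> L\<close> \<open>f \<le> L\<close> by (intro add_mono mult_mono) auto
    ultimately have "runs (learner_prog p) (val_of_learner_input x)
        (val_of_mat n f (ogd_learner xs x)) (poly Q L)"
      unfolding Q by (rule runs_weaken[OF _ refl])
    then show ?thesis unfolding runs_def by (simp only: L_def xeq prod.case)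
  qed
  then show ?thesis unfolding poly_time_learner_def poly_time_def by blast
qed

section \<open>The loss function\<close>

text \<open>The reverse triangle inequality in each row. It feeds the range of loss differences on
  the box, the size of arbitrary subgradients, and the Lipschitz bounds behind the existence of
  optimal comparators.\<close>

lemma loss_diff_bound:
  "\<bar>loss xs n E f (c, b, \<phi>) A' - loss xs n E f (c, b, \<phi>) A\<bar>
    \<le> (\<Sum>i<n. real (b i) * (\<Sum>j<f. \<bar>A' i j - A i j\<bar> * \<bar>\<phi> j\<bar>))"
proof -
  have row: "\<bar>\<bar>mat_vec f A' \<phi> i - x\<bar> - \<bar>mat_vec f A \<phi> i - x\<bar>\<bar> \<le> (\<Sum>j<f. \<bar>A' i j - A i j\<bar> * \<bar>\<phi> j\<bar>)" for i x
  proof -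
    have "\<bar>\<bar>mat_vec f A' \<phi> i - x\<bar> - \<bar>mat_vec f A \<phi> i - x\<bar>\<bar> \<le> \<bar>mat_vec f A' \<phi> i - mat_vec f A \<phi> i\<bar>"
      by linarith
    also have "\<dots> = \<bar>\<Sum>j<f. (A' i j - A i j) * \<phi> j\<bar>"
      by (simp add: mat_vec_def sum_subtractf left_diff_distrib)
    also have "\<dots> \<le> (\<Sum>j<f. \<bar>A' i j - A i j\<bar> * \<bar>\<phi> j\<bar>)"
      using sum_abs[of "\<lambda>j. (A' i j - A i j) * \<phi> j" "{..<f}"] by (simp add: abs_mult)
    finally show ?thesis .
  qed
  have "\<bar>loss xs n E f (c, b, \<phi>) A' - loss xs n E f (c, b, \<phi>) A\<bar> =
    \<bar>\<Sum>i<n. real (b i) * (\<bar>mat_vec f A' \<phi> i - real_of_int (xs n E c b i)\<bar> -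
      \<bar>mat_vec f A \<phi> i - real_of_int (xs n E c b i)\<bar>)\<bar>"
    by (simp add: loss_def seminorm1_def sum_subtractf right_diff_distrib)
  also have "\<dots> \<le> (\<Sum>i<n. real (b i) * (\<Sum>j<f. \<bar>A' i j - A i j\<bar> * \<bar>\<phi> j\<bar>))"
    by (rule order_trans[OF sum_abs])
      (auto simp: abs_mult intro!: sum_mono mult_left_mono row)
  finally show ?thesis .
qed

lemma sum_single_entry:
  fixes h :: "nat \<Rightarrow> nat \<Rightarrow> real"
  assumes "i < n" "j < f" "\<And>i' j'. (i', j') \<noteq> (i, j) \<Longrightarrow> h i' j' = 0"
  shows "(\<Sum>i'<n. \<Sum>j'<f. h i' j') = h i j"
proof -
  have "(\<Sum>i'<n. \<Sum>j'<f. h i' j') = (\<Sum>i'<n. \<Sum>j'<f. if j' = j then if i' = i then h i j else 0 else 0)"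
    using assms(3) by (intro sum.cong refl) auto
  then show ?thesis using assms(1,2) by simp
qed

lemma valid_sampleD:
  assumes "valid_sample n E f C B (c, b, \<phi>)"
  shows "\<And>j. j < f \<Longrightarrow> \<phi> j \<ge> 0" "(\<Sum>j<f. \<phi> j) = 1" "\<And>i. i < n \<Longrightarrow> real (b i) \<le> B"
  using assms by (auto simp: valid_sample_def prob_simplex_def PiE_def Pi_def)

text \<open>This removes f from the bound on the squared gradient norm, leaving n B^2.\<close>

lemma simplex_sum_squares_le:
  fixes \<phi> :: "nat \<Rightarrow> real"
  assumes "\<And>j. j < f \<Longrightarrow> \<phi> j \<ge> 0" "(\<Sum>j<f. \<phi> j) = 1"
  shows "(\<Sum>j<f. (\<phi> j)\<^sup>2) \<le> 1"
proof -
  have "\<phi> j \<le> 1" if "j < f" for j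
    using member_le_sum[of j "{..<f}" \<phi>] assms that by auto
  then have "(\<Sum>j<f. (\<phi> j)\<^sup>2) \<le> (\<Sum>j<f. \<phi> j)"
    using assms(1) by (intro sum_mono) (auto simp: power2_eq_square intro: mult_left_le)
  then show ?thesis using assms(2) by simp
qed

text \<open>A probability vector averages entry differences of at most 2C, so each of the n rows
  contributes at most 2CB whatever f is.\<close>

lemma loss_diff_mat_box:
  assumes v: "valid_sample n E f C B s" and C: "C \<ge> 0"
    and A: "A \<in> mat_box n f C" "A' \<in> mat_box n f C"
  shows "\<bar>loss xs n E f s A' - loss xs n E f s A\<bar> \<le> 2 * (C * B * real n)"
proof -
  obtain c b \<phi> where s: "s = (c, b, \<phi>)" by (metis surj_pair)
  note v = valid_sampleD[OF v[unfolded s]]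
  have "(\<Sum>j<f. \<bar>A' i j - A i j\<bar> * \<bar>\<phi> j\<bar>) \<le> 2 * C" if "i < n" for i
  proof -
    have "\<bar>A' i j - A i j\<bar> * \<bar>\<phi> j\<bar> \<le> 2 * C * \<phi> j" if "j < f" for j
    proof -
      have "A i j \<in> {-C..C}" "A' i j \<in> {-C..C}"
        using A \<open>i < n\<close> \<open>j < f\<close> by (simp_all add: mat_box_def)
      then show ?thesis using v(1)[OF that] by (auto intro!: mult_mono)
    qed
    then have "(\<Sum>j<f. \<bar>A' i j - A i j\<bar> * \<bar>\<phi> j\<bar>) \<le> (\<Sum>j<f. 2 * C * \<phi> j)"
      by (intro sum_mono) auto
    also have "\<dots> = 2 * C" using v(2) by (simp flip: sum_distrib_left)
    finally show ?thesis .
  qed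
  then have "(\<Sum>i<n. real (b i) * (\<Sum>j<f. \<bar>A' i j - A i j\<bar> * \<bar>\<phi> j\<bar>)) \<le> (\<Sum>i<n. B * (2 * C))"
    using v(3) C by (intro sum_mono mult_mono) (auto intro: order_trans[OF of_nat_0_le_iff] sum_nonneg)
  with loss_diff_bound[of xs n E f c b \<phi> A' A] show ?thesis by (simp add: s algebra_simps)
qed

lemma subgradient_diff_le:
  assumes "is_subgradient n f U A G"
  shows "U A - U Z \<le> frob_inner n f G (\<lambda>i j. A i j - Z i j)"
proof -
  have "U A + frob_inner n f G (\<lambda>i j. Z i j - A i j) \<le> U Z"
    using assms by (simp add: is_subgradient_def)
  moreover have "frob_inner n f G (\<lambda>i j. Z i j - A i j) = - frob_inner n f G (\<lambda>i j. A i j - Z i j)"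
    by (simp add: frob_inner_def right_diff_distrib sum_subtractf)
  ultimately show ?thesis by linarith
qed

text \<open>The line of slope b_i or -b_i touches b_i times the absolute value at the current
  residual and lies below it elsewhere; at residual 0 either slope would do.\<close>

lemma is_subgradient_loss:
  "is_subgradient n f (loss xs n E f s) A (loss_subgradient xs n E f s A)"
  unfolding is_subgradient_def
proof
  fix A'
  obtain c b \<phi> where s: "s = (c, b, \<phi>)" by (metis surj_pair)
  let ?x = "\<lambda>i. real_of_int (xs n E c b i)"
  let ?\<sigma> = "\<lambda>i. if mat_vec f A \<phi> i < ?x i then - real (b i) else real (b i)"
  have "frob_inner n f (loss_subgradient xs n E f s A) (\<lambda>i j. A' i j - A i j) =
      (\<Sum>i<n. ?\<sigma> i * (mat_vec f A' \<phi> i - mat_vec f A \<phi> i))"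
    by (simp add: frob_inner_def loss_subgradient_def s mat_vec_def sum_distrib_left
      flip: sum_subtractf) (auto intro!: sum.cong simp: algebra_simps)
  moreover have "loss xs n E f s A + (\<Sum>i<n. ?\<sigma> i * (mat_vec f A' \<phi> i - mat_vec f A \<phi> i)) =
      (\<Sum>i<n. real (b i) * \<bar>mat_vec f A \<phi> i - ?x i\<bar> + ?\<sigma> i * (mat_vec f A' \<phi> i - mat_vec f A \<phi> i))"
    by (simp add: loss_def seminorm1_def s sum.distrib)
  moreover have "\<dots> \<le> (\<Sum>i<n. real (b i) * \<bar>mat_vec f A' \<phi> i - ?x i\<bar>)"
  proof (rule sum_mono)
    fix i
    show "real (b i) * \<bar>mat_vec f A \<phi> i - ?x i\<bar> + ?\<sigma> i * (mat_vec f A' \<phi> i - mat_vec f A \<phi> i)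
      \<le> real (b i) * \<bar>mat_vec f A' \<phi> i - ?x i\<bar>"
    proof (cases "mat_vec f A \<phi> i < ?x i")
      case True
      have "real (b i) * (?x i - mat_vec f A' \<phi> i) \<le> real (b i) * \<bar>mat_vec f A' \<phi> i - ?x i\<bar>"
        by (intro mult_left_mono) auto
      with True show ?thesis by (simp add: algebra_simps)
    next
      case False
      have "real (b i) * (mat_vec f A' \<phi> i - ?x i) \<le> real (b i) * \<bar>mat_vec f A' \<phi> i - ?x i\<bar>"
        by (intro mult_left_mono) auto
      with False show ?thesis by (simp add: algebra_simps)
    qed
  qed
  ultimately show "loss xs n E f s A + frob_inner n f (loss_subgradient xs n E f s A) (\<lambda>i j. A' i j - A i j)
      \<le> loss xs n E f s A'"
    by (simp add: loss_def seminorm1_def s)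
qed

text \<open>OGD may pick any subgradient, so the bound cannot rely on a formula. Moving one entry by
  1 or -1 changes the loss by at most b_i \<bar>\<phi>_j\<bar>. The moved matrix may leave the box,
  which is allowed because subgradients refer to all matrices.\<close>

lemma subgradient_entry_bound:
  assumes G: "is_subgradient n f (loss xs n E f (c, b, \<phi>)) A G" and ij: "i < n" "j < f"
  shows "\<bar>G i j\<bar> \<le> real (b i) * \<bar>\<phi> j\<bar>"
proof -
  have "\<delta> * G i j \<le> real (b i) * \<bar>\<phi> j\<bar>" if "\<bar>\<delta>\<bar> = 1" for \<delta> :: real
  proof -
    define A' where "A' = (\<lambda>i' j'. A i' j' + (if i' = i \<and> j' = j then \<delta> else 0))"
    have "frob_inner n f G (\<lambda>i j. A' i j - A i j) =
        G i j * (A' i j - A i j)"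
      unfolding frob_inner_def using ij by (intro sum_single_entry) (auto simp: A'_def)
    moreover have "loss xs n E f (c, b, \<phi>) A + frob_inner n f G (\<lambda>i j. A' i j - A i j)
        \<le> loss xs n E f (c, b, \<phi>) A'"
      using G by (simp add: is_subgradient_def)
    ultimately have "loss xs n E f (c, b, \<phi>) A + \<delta> * G i j \<le> loss xs n E f (c, b, \<phi>) A'"
      by (simp add: A'_def mult.commute)
    moreover have "(\<Sum>i'<n. \<Sum>j'<f. real (b i') * (\<bar>A' i' j' - A i' j'\<bar> * \<bar>\<phi> j'\<bar>)) =
        real (b i) * (\<bar>A' i j - A i j\<bar> * \<bar>\<phi> j\<bar>)"
      using ij by (intro sum_single_entry) (auto simp: A'_def)
    then have "(\<Sum>i'<n. real (b i') * (\<Sum>j'<f. \<bar>A' i' j' - A i' j'\<bar> * \<bar>\<phi> j'\<bar>)) = real (b i) * \<bar>\<phi> j\<bar>"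
      using that by (simp add: A'_def sum_distrib_left)
    ultimately show ?thesis using loss_diff_bound[of xs n E f c b \<phi> A' A] by linarith
  qed
  from this[of 1] this[of "-1"] show ?thesis by simp
qed

lemma subgradient_norm_bound:
  assumes G: "is_subgradient n f (loss xs n E f s) A G" and v: "valid_sample n E f C B s" and B: "B \<ge> 0"
  shows "(\<Sum>i<n. \<Sum>j<f. (G i j)\<^sup>2) \<le> real n * B\<^sup>2"
proof -
  obtain c b \<phi> where s: "s = (c, b, \<phi>)" by (metis surj_pair)
  note v = valid_sampleD[OF v[unfolded s]]
  have "(\<Sum>j<f. (G i j)\<^sup>2) \<le> B\<^sup>2" if i: "i < n" for i
  proof -
    have "(G i j)\<^sup>2 \<le> B\<^sup>2 * (\<phi> j)\<^sup>2" if j: "j < f" for j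
    proof -
      have "\<bar>G i j\<bar> \<le> B * \<phi> j"
        using subgradient_entry_bound[OF G[unfolded s] i j] v(1)[OF j] mult_right_mono[OF v(3)[OF i] v(1)[OF j]]
        by simp
      then have "\<bar>G i j\<bar>\<^sup>2 \<le> (B * \<phi> j)\<^sup>2" by (intro power_mono) auto
      then show ?thesis by (simp add: power_mult_distrib)
    qed
    then have "(\<Sum>j<f. (G i j)\<^sup>2) \<le> (\<Sum>j<f. B\<^sup>2 * (\<phi> j)\<^sup>2)" by (intro sum_mono) auto
    also have "\<dots> = B\<^sup>2 * (\<Sum>j<f. (\<phi> j)\<^sup>2)" by (simp add: sum_distrib_left)
    also have "\<dots> \<le> B\<^sup>2" using simplex_sum_squares_le[OF v(1,2)] by (simp add: mult_left_le)
    finally show ?thesis .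
  qed
  then have "(\<Sum>i<n. \<Sum>j<f. (G i j)\<^sup>2) \<le> (\<Sum>i<n. B\<^sup>2)" by (intro sum_mono) auto
  then show ?thesis by simp
qed


section \<open>Regret of projected subgradient descent\<close>

lemma clip_bounds:
  assumes "C \<ge> 0"
  shows "- C \<le> clip C y" "clip C y \<le> C"
  using assms by (auto simp: clip_def)

text \<open>The obtuse-angle characterisation of the projection onto an interval.\<close>

lemma clip_variational:
  assumes "\<bar>z\<bar> \<le> C"
  shows "(clip C w - w) * (z - clip C w) \<ge> 0"
  using assms by (auto simp: clip_def abs_le_iff intro: mult_nonneg_nonneg mult_nonpos_nonpos)

text \<open>Let y be the projected point. The variational inequality gives g (y - z) \<le> (y - a)
  (z - y), which is half of (z - a)^2 - (y - a)^2 - (z - y)^2. Adding g (a - y) \<le> (g^2 + (a -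
  y)^2) / 2 cancels the term (y - a)^2.\<close>

lemma clip_descent:
  assumes z: "\<bar>z\<bar> \<le> C"
  shows "g * (a - z) \<le> ((z - a)\<^sup>2 - (z - clip C (a - g))\<^sup>2 + g\<^sup>2) / 2"
proof -
  define y where "y = clip C (a - g)"
  have "(y - (a - g)) * (z - y) \<ge> 0" unfolding y_def by (rule clip_variational[OF z])
  moreover have "(g - (a - y))\<^sup>2 \<ge> 0" by simp
  ultimately have "g * (a - z) \<le> ((z - a)\<^sup>2 - (z - y)\<^sup>2 + g\<^sup>2) / 2"
    by (simp add: power2_eq_square algebra_simps)
  then show ?thesis by (simp add: y_def)
qed

text \<open>The potential is the squared Frobenius distance to the comparator: it telescopes, and
  starts at no more than n f C^2 because the first iterate is 0. The lemma serves both adversarial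
  OGD and the learner.\<close>

lemma clipped_descent_regret:
  fixes As G :: "nat \<Rightarrow> matrix"
  assumes \<alpha>: "\<alpha> > 0"
    and init: "\<And>i j. i < n \<Longrightarrow> j < f \<Longrightarrow> As 0 i j = 0"
    and step: "\<And>t i j. t < T \<Longrightarrow> i < n \<Longrightarrow> j < f \<Longrightarrow> As (Suc t) i j = clip C (As t i j - \<alpha> * G t i j)"
    and V: "\<And>t. t < T \<Longrightarrow> (\<Sum>i<n. \<Sum>j<f. (G t i j)\<^sup>2) \<le> V"
    and Z: "Z \<in> mat_box n f C"
  shows "(\<Sum>t<T. frob_inner n f (G t) (\<lambda>i j. As t i j - Z i j))
    \<le> real n * real f * C\<^sup>2 / (2 * \<alpha>) + \<alpha> * real T * V / 2"
proof -
  have Z': "\<bar>Z i j\<bar> \<le> C" if "i < n" "j < f" for i j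
    using Z that by (force simp: mat_box_def abs_le_iff)
  define \<Phi> where "\<Phi> t = (\<Sum>i<n. \<Sum>j<f. (Z i j - As t i j)\<^sup>2)" for t
  have one: "\<alpha> * frob_inner n f (G t) (\<lambda>i j. As t i j - Z i j) \<le> (\<Phi> t - \<Phi> (Suc t) + \<alpha>\<^sup>2 * V) / 2"
    if t: "t < T" for t
  proof -
    have "\<alpha> * frob_inner n f (G t) (\<lambda>i j. As t i j - Z i j) =
        (\<Sum>i<n. \<Sum>j<f. (\<alpha> * G t i j) * (As t i j - Z i j))"
      by (simp add: frob_inner_def sum_distrib_left mult.assoc)
    also have "\<dots> \<le> (\<Sum>i<n. \<Sum>j<f.
        ((Z i j - As t i j)\<^sup>2 - (Z i j - As (Suc t) i j)\<^sup>2 + (\<alpha> * G t i j)\<^sup>2) / 2)"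
    proof (intro sum_mono)
      fix i j assume "i \<in> {..<n}" "j \<in> {..<f}"
      then have ij: "i < n" "j < f" by auto
      show "\<alpha> * G t i j * (As t i j - Z i j) \<le>
          ((Z i j - As t i j)\<^sup>2 - (Z i j - As (Suc t) i j)\<^sup>2 + (\<alpha> * G t i j)\<^sup>2) / 2"
        unfolding step[OF t ij] by (rule clip_descent[OF Z'[OF ij]])
    qed
    also have "\<dots> = (\<Phi> t - \<Phi> (Suc t) + \<alpha>\<^sup>2 * (\<Sum>i<n. \<Sum>j<f. (G t i j)\<^sup>2)) / 2"
      by (simp add: \<Phi>_def sum.distrib sum_subtractf power_mult_distrib sum_distrib_left
        flip: sum_divide_distrib)
    also have "\<dots> \<le> (\<Phi> t - \<Phi> (Suc t) + \<alpha>\<^sup>2 * V) / 2"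
      using V[OF t] by (intro divide_right_mono add_left_mono mult_left_mono) auto
    finally show ?thesis .
  qed
  have "\<alpha> * (\<Sum>t<T. frob_inner n f (G t) (\<lambda>i j. As t i j - Z i j)) \<le>
      (\<Sum>t<T. (\<Phi> t - \<Phi> (Suc t) + \<alpha>\<^sup>2 * V) / 2)"
    unfolding sum_distrib_left by (intro sum_mono one) auto
  also have "\<dots> = (\<Phi> 0 - \<Phi> T + real T * \<alpha>\<^sup>2 * V) / 2"
    by (simp add: sum.distrib sum_lessThan_telescope' flip: sum_divide_distrib)
  also have "\<dots> \<le> (real n * real f * C\<^sup>2 + real T * \<alpha>\<^sup>2 * V) / 2"
  proof -
    have "\<Phi> T \<ge> 0" by (auto simp: \<Phi>_def intro!: sum_nonneg)
    moreover have "\<Phi> 0 \<le> (\<Sum>i<n. \<Sum>j<f. C\<^sup>2)"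
      unfolding \<Phi>_def
    proof (intro sum_mono)
      fix i j assume ij: "i \<in> {..<n}" "j \<in> {..<f}"
      have "\<bar>Z i j\<bar>\<^sup>2 \<le> C\<^sup>2" using ij by (intro power_mono Z') auto
      with ij init show "(Z i j - As 0 i j)\<^sup>2 \<le> C\<^sup>2" by simp
    qed
    ultimately show ?thesis by simp
  qed
  also have "\<dots> = \<alpha> * (real n * real f * C\<^sup>2 / (2 * \<alpha>) + \<alpha> * real T * V / 2)"
    using \<alpha> by (simp add: field_simps power2_eq_square)
  finally show ?thesis using \<alpha> by (simp only: mult_le_cancel_left_pos)
qed

text \<open>The objective is separable, so the minimizer is compared with the matrix in which only
  entry (i, j) is replaced by its clipped value. Strong convexity and the variational inequality
  leave minus half the square of the discrepancy as an upper bound for the change, which optimality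
  makes nonnegative.\<close>

lemma projected_step_eq_clip:
  assumes "is_arg_min
      (\<lambda>A. \<alpha> * frob_inner n f G A + 1/2 * frob_inner n f (\<lambda>i j. A i j - A\<^sub>t i j) (\<lambda>i j. A i j - A\<^sub>t i j))
      (\<lambda>A. A \<in> mat_box n f C) A\<^sub>1" (is "is_arg_min ?h _ _")
    and ij: "i < n" "j < f" and C: "C \<ge> 0"
  shows "A\<^sub>1 i j = clip C (A\<^sub>t i j - \<alpha> * G i j)"
proof -
  define w where "w = A\<^sub>t i j - \<alpha> * G i j"
  define Y where "Y = (\<lambda>i' j'. if i' = i \<and> j' = j then clip C w else A\<^sub>1 i' j')"
  have box: "A\<^sub>1 \<in> mat_box n f C" and min: "\<And>A. A \<in> mat_box n f C \<Longrightarrow> ?h A\<^sub>1 \<le> ?h A"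
    using assms(1) by (auto simp: is_arg_min_linorder)
  have "Y \<in> mat_box n f C"
    using box clip_bounds[OF C, of w] by (auto simp: mat_box_def Y_def)
  from min[OF this] have "0 \<le> ?h Y - ?h A\<^sub>1" by simp
  also have "?h Y - ?h A\<^sub>1 = (\<Sum>i'<n. \<Sum>j'<f.
      \<alpha> * G i' j' * (Y i' j' - A\<^sub>1 i' j') + ((Y i' j' - A\<^sub>t i' j')\<^sup>2 - (A\<^sub>1 i' j' - A\<^sub>t i' j')\<^sup>2) / 2)"
    by (simp add: frob_inner_def sum_distrib_left power2_eq_square algebra_simps add_divide_distrib diff_divide_distrib
      flip: sum_subtractf sum.distrib)
  also have "\<dots> = \<alpha> * G i j * (Y i j - A\<^sub>1 i j) + ((Y i j - A\<^sub>t i j)\<^sup>2 - (A\<^sub>1 i j - A\<^sub>t i j)\<^sup>2) / 2"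
    using ij by (intro sum_single_entry) (auto simp: Y_def)
  also have "\<dots> = \<alpha> * G i j * (clip C w - A\<^sub>1 i j) + ((clip C w - A\<^sub>t i j)\<^sup>2 - (A\<^sub>1 i j - A\<^sub>t i j)\<^sup>2) / 2"
    by (simp add: Y_def)
  also have "\<dots> = - ((clip C w - w) * (A\<^sub>1 i j - clip C w)) - (A\<^sub>1 i j - clip C w)\<^sup>2 / 2"
    by (simp add: w_def power2_eq_square field_simps)
  finally have *: "0 \<le> - ((clip C w - w) * (A\<^sub>1 i j - clip C w)) - (A\<^sub>1 i j - clip C w)\<^sup>2 / 2" .
  have "A\<^sub>1 i j \<in> {-C..C}" using box ij by (simp add: mat_box_def)
  then have "(clip C w - w) * (A\<^sub>1 i j - clip C w) \<ge> 0"
    by (intro clip_variational) (simp add: abs_le_iff)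
  with * have "(A\<^sub>1 i j - clip C w)\<^sup>2 \<le> 0" by linarith
  then show ?thesis by (simp add: w_def)
qed

section \<open>Existence of comparators\<close>

lemma max_norm_le_iff:
  assumes "n \<ge> 1" "f \<ge> 1"
  shows "max_norm n f A \<le> C \<longleftrightarrow> A \<in> mat_box n f C"
proof -
  have "{..<n} \<times> {..<f} \<noteq> {}" using assms by (auto simp: lessThan_empty_iff)
  then have "max_norm n f A \<le> C \<longleftrightarrow> (\<forall>i<n. \<forall>j<f. \<bar>A i j\<bar> \<le> C)"
    by (auto simp: max_norm_def)
  moreover have "\<bar>x\<bar> \<le> C \<longleftrightarrow> x \<in> {-C..C}" for x by auto
  ultimately show ?thesis by (simp only: mat_box_def mem_Collect_eq)
qed

text \<open>Tychonoff's theorem in the product topology on functions.\<close>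

lemma compact_PiE_UNIV:
  fixes X :: "'a \<Rightarrow> 'b :: topological_space set"
  assumes "\<And>i. compact (X i)"
  shows "compact (PiE UNIV X)"
  using compactin_PiE[of "\<lambda>_. euclidean" UNIV X] assms by (simp add: euclidean_product_topology)

text \<open>Matrices are functions on all pairs of naturals, so the box leaves infinitely many
  entries free and is not compact. Fixing these at 0 gives a compact set, and the Lipschitz
  hypothesis, whose sum sees only entries in range, gives both continuity and independence of the
  others.\<close>

lemma ex_arg_min_max_norm:
  fixes F :: "matrix \<Rightarrow> real"
  assumes nf: "n \<ge> 1" "f \<ge> 1" and C: "C \<ge> 0"
    and lip: "\<And>A A'. \<bar>F A' - F A\<bar> \<le> K * (\<Sum>i<n. \<Sum>j<f. \<bar>A' i j - A i j\<bar>)"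
  shows "\<exists>A\<^sub>0. is_arg_min F (\<lambda>A. max_norm n f A \<le> C) A\<^sub>0"
proof -
  define X :: "matrix set" where
    "X = PiE UNIV (\<lambda>i. PiE UNIV (\<lambda>j. if i < n \<and> j < f then {-C..C} else {0}))"
  have "compact X" unfolding X_def
    by (intro compact_PiE_UNIV) auto
  moreover have "X \<noteq> {}"
    using C by (auto simp: X_def PiE_eq_empty_iff)
  moreover have "continuous_on UNIV F"
    unfolding continuous_on_def
  proof
    fix A :: matrix
    have "((\<lambda>A' :: matrix. A' i j) \<longlongrightarrow> A i j) (at A)" for i j
    proof -
      have "continuous_on UNIV (\<lambda>A' :: matrix. A' i j)"
        using continuous_on_product_coordinates[of j] continuous_on_product_coordinates[of i]
        by (rule continuous_on_compose2[where t = UNIV and f = "\<lambda>A' :: matrix. A' i"]) auto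
      then show ?thesis by (simp add: continuous_on_def)
    qed
    then have "((\<lambda>A' :: matrix. \<bar>A' i j - A i j\<bar>) \<longlongrightarrow> \<bar>A i j - A i j\<bar>) (at A)" for i j
      by (rule tendsto_rabs[OF tendsto_diff[OF _ tendsto_const]])
    then have "((\<lambda>A' :: matrix. \<Sum>i<n. \<Sum>j<f. \<bar>A' i j - A i j\<bar>) \<longlongrightarrow> (\<Sum>i<n. \<Sum>j<f. \<bar>A i j - A i j\<bar>)) (at A)"
      by (rule tendsto_sum[OF tendsto_sum])
    from tendsto_mult[OF tendsto_const this, of K]
    have "((\<lambda>A' :: matrix. K * (\<Sum>i<n. \<Sum>j<f. \<bar>A' i j - A i j\<bar>)) \<longlongrightarrow> 0) (at A)"
      by simp
    then have "((\<lambda>A'. F A' - F A) \<longlongrightarrow> 0) (at A)"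
      by (rule Lim_null_comparison[OF always_eventually, rotated]) (use lip in simp)
    then show "(F \<longlongrightarrow> F A) (at A within UNIV)" by (simp add: LIM_zero_iff)
  qed
  ultimately obtain A\<^sub>0 where A0: "A\<^sub>0 \<in> X" "\<And>A. A \<in> X \<Longrightarrow> F A\<^sub>0 \<le> F A"
    using continuous_attains_inf[of X F] continuous_on_subset by blast
  have "F A\<^sub>0 \<le> F A" if A: "A \<in> mat_box n f C" for A
  proof -
    define A' :: matrix where "A' = (\<lambda>i j. if i < n \<and> j < f then A i j else 0)"
    have "A' \<in> X" using A by (auto simp: X_def A'_def mat_box_def)
    moreover have "(\<Sum>i<n. \<Sum>j<f. \<bar>A' i j - A i j\<bar>) = 0" by (simp add: A'_def)
    then have "F A' = F A" using lip[of A' A] by simp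
    ultimately show ?thesis using A0(2) by metis
  qed
  moreover have "A\<^sub>0 \<in> mat_box n f C"
  proof -
    have "A\<^sub>0 i j \<in> (if i < n \<and> j < f then {-C..C} else {0})" for i j
      by (rule PiE_mem[OF PiE_mem[OF A0(1)[unfolded X_def] UNIV_I] UNIV_I])
    then show ?thesis unfolding mat_box_def mem_Collect_eq by (metis (full_types))
  qed
  ultimately show ?thesis
    by (auto simp: is_arg_min_linorder max_norm_le_iff[OF nf])
qed

lemma loss_lipschitz:
  assumes "\<forall>i<n. real (b i) \<le> K" "\<forall>j<f. \<bar>\<phi> j\<bar> \<le> 1" "K \<ge> 0"
  shows "\<bar>loss xs n E f (c, b, \<phi>) A' - loss xs n E f (c, b, \<phi>) A\<bar>
    \<le> K * (\<Sum>i<n. \<Sum>j<f. \<bar>A' i j - A i j\<bar>)"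
proof -
  have "(\<Sum>i<n. real (b i) * (\<Sum>j<f. \<bar>A' i j - A i j\<bar> * \<bar>\<phi> j\<bar>)) \<le>
      (\<Sum>i<n. K * (\<Sum>j<f. \<bar>A' i j - A i j\<bar>))"
    using assms by (intro sum_mono mult_mono) (auto intro!: sum_nonneg mult_left_le)
  with loss_diff_bound[of xs n E f c b \<phi> A' A] show ?thesis by (simp add: sum_distrib_left)
qed

lemma valid_sample_loss_lipschitz:
  assumes v: "valid_sample n E f C B s" and B: "B \<ge> 0"
  shows "\<bar>loss xs n E f s A' - loss xs n E f s A\<bar> \<le> B * (\<Sum>i<n. \<Sum>j<f. \<bar>A' i j - A i j\<bar>)"
proof -
  obtain c b \<phi> where s: "s = (c, b, \<phi>)" by (metis surj_pair)
  note v = valid_sampleD[OF v[unfolded s]]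
  have "\<phi> j \<le> 1" if "j < f" for j
    using member_le_sum[of j "{..<f}" \<phi>] v(1,2) that by auto
  with v B show ?thesis unfolding s by (intro loss_lipschitz) (auto simp: abs_le_iff)
qed

section \<open>The online guarantee\<close>

theorem online_regret:
  assumes n: "n \<ge> 1" and f: "f \<ge> 1" and C: "C \<ge> 0" and B: "B \<ge> 0"
  shows "\<exists>\<alpha> > 0. \<forall>xs E S As.
    (\<forall>t<T. valid_sample n E f C B (S t)) \<and>
    ogd_iterates n f (mat_box n f C) \<alpha> T (\<lambda>t. loss xs n E f (S t)) As \<longrightarrow>
    (\<exists>A\<^sub>0. is_arg_max (regret T (\<lambda>t. loss xs n E f (S t)) As) (\<lambda>A. max_norm n f A \<le> C) A\<^sub>0 \<and>
      regret T (\<lambda>t. loss xs n E f (S t)) As A\<^sub>0 \<le> C * B * real n * real f * sqrt (2 * real T))"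
proof -
  \<comment> \<open>Minimizes n f C^2 / (2\<alpha>) + \<alpha> T n B^2 / 2; n is a common factor and
    drops out. If C B T = 0 the fraction need not be positive, but any step-size then works.\<close>
  define \<alpha> where "\<alpha> = (if C * B * real T = 0 then 1 else C * sqrt (real f) / (B * sqrt (real T)))"
  have \<alpha>: "\<alpha> > 0"
    using B C f by (auto simp: \<alpha>_def intro!: divide_pos_pos mult_pos_pos)
  have goal: "\<exists>A\<^sub>0. is_arg_max (regret T U As) (\<lambda>A. max_norm n f A \<le> C) A\<^sub>0 \<and>
      regret T U As A\<^sub>0 \<le> C * B * real n * real f * sqrt (2 * real T)"
    if v: "\<And>t. t < T \<Longrightarrow> valid_sample n E f C B (S t)" and U: "U = (\<lambda>t. loss xs n E f (S t))"
      and it: "ogd_iterates n f (mat_box n f C) \<alpha> T U As" for xs E S As U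
  proof -
    have U_lip: "\<bar>U t A' - U t A\<bar> \<le> B * (\<Sum>i<n. \<Sum>j<f. \<bar>A' i j - A i j\<bar>)" if "t < T" for t A A'
      unfolding U by (rule valid_sample_loss_lipschitz[OF v[OF that] B])
    have "\<bar>(\<Sum>t<T. U t A') - (\<Sum>t<T. U t A)\<bar> \<le> (real T * B) * (\<Sum>i<n. \<Sum>j<f. \<bar>A' i j - A i j\<bar>)" for A A'
    proof -
      have "\<bar>\<Sum>t<T. U t A' - U t A\<bar> \<le> (\<Sum>t<T. B * (\<Sum>i<n. \<Sum>j<f. \<bar>A' i j - A i j\<bar>))"
        by (rule order_trans[OF sum_abs]) (intro sum_mono U_lip, simp)
      then show ?thesis by (simp add: sum_subtractf)
    qed
    \<comment> \<open>The cost of the iterates does not depend on the comparator, so maximal regret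
      means minimal cumulative loss.\<close>
    from ex_arg_min_max_norm[OF n f C this] obtain A\<^sub>0
      where A0: "is_arg_min (\<lambda>A. \<Sum>t<T. U t A) (\<lambda>A. max_norm n f A \<le> C) A\<^sub>0" by blast
    have reg: "regret T U As A = (\<Sum>t<T. U t (As t)) - (\<Sum>t<T. U t A)" for A
      by (simp add: regret_def sum_subtractf)
    have box0: "A\<^sub>0 \<in> mat_box n f C"
      using A0 by (simp add: is_arg_min_def max_norm_le_iff[OF n f])
    obtain G where sub: "\<And>t. t < T \<Longrightarrow> is_subgradient n f (U t) (As t) (G t)"
      and proj: "\<And>t. t < T \<Longrightarrow> is_arg_min
        (\<lambda>A. \<alpha> * frob_inner n f (G t) A +
          1/2 * frob_inner n f (\<lambda>i j. A i j - As t i j) (\<lambda>i j. A i j - As t i j))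
        (\<lambda>A. A \<in> mat_box n f C) (As (Suc t))"
    proof -
      from it have "\<forall>t<T. \<exists>G. is_subgradient n f (U t) (As t) G \<and> is_arg_min
        (\<lambda>A. \<alpha> * frob_inner n f G A +
          1/2 * frob_inner n f (\<lambda>i j. A i j - As t i j) (\<lambda>i j. A i j - As t i j))
        (\<lambda>A. A \<in> mat_box n f C) (As (Suc t))"
        unfolding ogd_iterates_def by (rule conjunct2)
      from this[unfolded choice_iff'] that show ?thesis by blast
    qed
    have init: "As 0 = (\<lambda>i j. 0)" using it by (simp add: ogd_iterates_def)
    have box: "As t \<in> mat_box n f C" if "t < T" for t
    proof (cases t)
      case 0
      then show ?thesis using C by (simp add: init mat_box_def)
    next
      case (Suc t')
      then show ?thesis using proj[of t'] that by (simp add: is_arg_min_def)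
    qed
    have "regret T U As A\<^sub>0 \<le> C * B * real n * real f * sqrt (2 * real T)"
    proof (cases "C * B * real T = 0")
      \<comment> \<open>Either there are no rounds, or C B = 0 and all losses are constant on the
        box.\<close>
      case True
      have "regret T U As A\<^sub>0 \<le> (\<Sum>t<T. 2 * (C * B * real n))"
        unfolding regret_def
      proof (rule sum_mono)
        fix t assume "t \<in> {..<T}"
        then have t: "t < T" by simp
        show "U t (As t) - U t A\<^sub>0 \<le> 2 * (C * B * real n)"
          using loss_diff_mat_box[OF v[OF t] C box0 box[OF t], of xs] unfolding U by linarith
      qed
      also have "\<dots> = 0" using True by auto
      also have "0 \<le> C * B * real n * real f * sqrt (2 * real T)" using C B by simp
      finally show ?thesis .
    next
      case False
      have "regret T U As A\<^sub>0 \<le> (\<Sum>t<T. frob_inner n f (G t) (\<lambda>i j. As t i j - A\<^sub>0 i j))"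
        unfolding regret_def
      proof (rule sum_mono)
        fix t assume "t \<in> {..<T}"
        then show "U t (As t) - U t A\<^sub>0 \<le> frob_inner n f (G t) (\<lambda>i j. As t i j - A\<^sub>0 i j)"
          by (intro subgradient_diff_le sub) simp
      qed
      also have "\<dots> \<le> real n * real f * C\<^sup>2 / (2 * \<alpha>) + \<alpha> * real T * (real n * B\<^sup>2) / 2"
      proof (rule clipped_descent_regret[OF \<alpha> _ _ _ box0])
        fix t assume t: "t < T"
        show "As (Suc t) i j = clip C (As t i j - \<alpha> * G t i j)" if "i < n" "j < f" for i j
          by (rule projected_step_eq_clip[OF proj[OF t] that C])
        show "(\<Sum>i<n. \<Sum>j<f. (G t i j)\<^sup>2) \<le> real n * B\<^sup>2"
          using sub[OF t] by (intro subgradient_norm_bound[OF _ v[OF t] B]) (simp add: U)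
      qed (simp add: init)
      \<comment> \<open>For this \<open>\<alpha>\<close> both terms are equal. The sharper bound is
        then relaxed by sqrt f \<le> f and sqrt T \<le> sqrt (2T).\<close>
      also have "\<dots> = C * B * real n * (sqrt (real f) * sqrt (real T))"
      proof -
        define p q where "p = sqrt (real f)" and "q = sqrt (real T)"
        have "real f = p * p" "real T = q * q" by (simp_all add: p_def q_def)
        moreover have "p > 0" "q > 0" "C > 0" "B > 0" using False f B C by (auto simp: p_def q_def)
        moreover have \<alpha>_eq: "\<alpha> = C * p / (B * q)" using False by (simp add: \<alpha>_def p_def q_def)
        ultimately show ?thesis
          unfolding p_def[symmetric] q_def[symmetric] \<alpha>_eq by (simp add: field_simps power2_eq_square)
      qed
      also have "\<dots> \<le> C * B * real n * (real f * sqrt (2 * real T))"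
      proof (intro mult_left_mono mult_mono)
        show "sqrt (real f) \<le> real f"
          using f by (intro real_le_lsqrt) (auto simp: power2_eq_square)
      qed (use C B in auto)
      finally show ?thesis by (simp add: mult.assoc)
    qed
    moreover have "is_arg_max (regret T U As) (\<lambda>A. max_norm n f A \<le> C) A\<^sub>0"
      using A0 by (auto simp: is_arg_max_def is_arg_min_def reg)
    ultimately show ?thesis by blast
  qed
  show ?thesis
    by (intro exI[of _ \<alpha>] conjI \<alpha> allI impI, elim conjE, rule goal) auto
qed

section \<open>Exponential moments of adapted sums\<close>

text \<open>By adaptedness \<open>\<omega>\<close> may be replaced by its restriction to the first t
  coordinates, so the function factors through the product space on which measurability is
  assumed.\<close>

lemma measurable_adapted:
  fixes g :: "nat \<Rightarrow> (nat \<Rightarrow> 'a) \<Rightarrow> 'a \<Rightarrow> real"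
  assumes meas: "(\<lambda>(\<omega>, s). g t \<omega> s) \<in> borel_measurable (PiM {..<t} (\<lambda>_. D) \<Otimes>\<^sub>M D)"
    and adapted: "\<And>\<omega> \<omega>' s. (\<And>k. k < t \<Longrightarrow> \<omega> k = \<omega>' k) \<Longrightarrow> g t \<omega> s = g t \<omega>' s"
    and t: "t < N"
  shows "(\<lambda>\<omega>. g t \<omega> (\<omega> t)) \<in> borel_measurable (PiM {..<N} (\<lambda>_. D))"
proof -
  have "(\<lambda>\<omega>. (restrict \<omega> {..<t}, \<omega> t)) \<in> PiM {..<N} (\<lambda>_. D) \<rightarrow>\<^sub>M PiM {..<t} (\<lambda>_. D) \<Otimes>\<^sub>M D"
    using t by (intro measurable_Pair measurable_restrict_subset measurable_component_singleton)
      auto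
  from measurable_compose[OF this meas]
  have "(\<lambda>\<omega>. g t (restrict \<omega> {..<t}) (\<omega> t)) \<in> borel_measurable (PiM {..<N} (\<lambda>_. D))"
    by simp
  also have "(\<lambda>\<omega>. g t (restrict \<omega> {..<t}) (\<omega> t)) = (\<lambda>\<omega>. g t \<omega> (\<omega> t))"
    by (intro ext adapted) auto
  finally show ?thesis .
qed

text \<open>Integrating out the last coordinate first leaves all earlier summands fixed, and the
  last factor is at most K for every prefix. This replaces the tower property; nonnegative integrals
  avoid integrability side conditions.\<close>

lemma nn_integral_exp_adapted_sum_le:
  fixes g :: "nat \<Rightarrow> (nat \<Rightarrow> 'a) \<Rightarrow> 'a \<Rightarrow> real"
  assumes D: "prob_space D"
    and meas: "\<And>t. (\<lambda>(\<omega>, s). g t \<omega> s) \<in> borel_measurable (PiM {..<t} (\<lambda>_. D) \<Otimes>\<^sub>M D)"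
    and adapted: "\<And>t \<omega> \<omega>' s. (\<And>k. k < t \<Longrightarrow> \<omega> k = \<omega>' k) \<Longrightarrow> g t \<omega> s = g t \<omega>' s"
    and step: "\<And>t \<omega>. \<omega> \<in> space (PiM {..<t} (\<lambda>_. D)) \<Longrightarrow> (\<integral>\<^sup>+s. ennreal (exp (l * g t \<omega> s)) \<partial>D) \<le> K"
  shows "(\<integral>\<^sup>+\<omega>. ennreal (exp (l * (\<Sum>t<N. g t \<omega> (\<omega> t)))) \<partial>(PiM {..<N} (\<lambda>_. D))) \<le> K ^ N"
proof (induction N)
  interpret D: prob_space D by (rule D)
  interpret P: product_prob_space "\<lambda>_ :: nat. D" UNIV ..
  {
    case 0
    show ?case by (simp add: PiM_empty)
  next
    case (Suc N)
    have [measurable]: "(\<lambda>\<omega>. g t \<omega> (\<omega> t)) \<in> borel_measurable (PiM {..<N} (\<lambda>_. D))" if "t < N" for t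
      using measurable_adapted[where g = g, OF meas adapted that] by blast
    have [measurable]: "(\<lambda>\<omega>. g t \<omega> (\<omega> t)) \<in> borel_measurable (PiM {..<Suc N} (\<lambda>_. D))" if "t < Suc N" for t
      using measurable_adapted[where g = g, OF meas adapted that] by blast
    let ?E = "\<lambda>N \<omega>. ennreal (exp (l * (\<Sum>t<N. g t \<omega> (\<omega> t))))"
    have E: "?E (Suc N) \<in> borel_measurable (PiM (insert N {..<N}) (\<lambda>_. D))"
      unfolding lessThan_Suc[symmetric] by measurable
    have "(\<integral>\<^sup>+\<omega>. ?E (Suc N) \<omega> \<partial>(PiM {..<Suc N} (\<lambda>_. D))) =
        (\<integral>\<^sup>+\<omega>. (\<integral>\<^sup>+s. ?E (Suc N) (fun_upd \<omega> N s) \<partial>D) \<partial>(PiM {..<N} (\<lambda>_. D)))"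
      using P.product_nn_integral_insert[OF _ _ E] by (simp add: lessThan_Suc)
    also have "\<dots> \<le> (\<integral>\<^sup>+\<omega>. ?E N \<omega> * K \<partial>(PiM {..<N} (\<lambda>_. D)))"
    proof (rule nn_integral_mono)
      fix \<omega> assume \<omega>: "\<omega> \<in> space (PiM {..<N} (\<lambda>_. D))"
      have gN: "(\<lambda>s. g N \<omega> s) \<in> borel_measurable D"
        using measurable_compose[OF measurable_Pair1'[OF \<omega>] meas[of N]] by simp
      have "?E (Suc N) (fun_upd \<omega> N s) = ?E N \<omega> * ennreal (exp (l * g N \<omega> s))" for s
      proof -
        have "g t (fun_upd \<omega> N s) ((fun_upd \<omega> N s) t) = g t \<omega> (\<omega> t)" if "t < N" for t
          using that adapted[of t "fun_upd \<omega> N s" \<omega>] by simp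
        moreover have "g N (fun_upd \<omega> N s) s = g N \<omega> s"
          by (rule adapted) simp
        ultimately show ?thesis
          by (simp add: distrib_left exp_add ennreal_mult)
      qed
      then have "(\<integral>\<^sup>+s. ?E (Suc N) (fun_upd \<omega> N s) \<partial>D) = ?E N \<omega> * (\<integral>\<^sup>+s. ennreal (exp (l * g N \<omega> s)) \<partial>D)"
        using gN by (simp add: nn_integral_cmult)
      also have "\<dots> \<le> ?E N \<omega> * K"
        by (intro mult_left_mono step \<omega>) auto
      finally show "(\<integral>\<^sup>+s. ?E (Suc N) (fun_upd \<omega> N s) \<partial>D) \<le> ?E N \<omega> * K" .
    qed
    also have "\<dots> = (\<integral>\<^sup>+\<omega>. ?E N \<omega> \<partial>(PiM {..<N} (\<lambda>_. D))) * K"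
      by (intro nn_integral_multc) measurable
    also have "\<dots> \<le> K ^ N * K"
      by (intro mult_right_mono Suc) auto
    finally show ?case by (simp add: mult.commute)
  }
qed

text \<open>Chernoff's method: Hoeffding's lemma on [-c, c] bounds each conditional moment by exp
  (l^2 c^2 / 2), uniformly in the past.\<close>

lemma azuma_adapted_sum:
  fixes h :: "nat \<Rightarrow> (nat \<Rightarrow> 'a) \<Rightarrow> 'a \<Rightarrow> real"
  assumes D: "prob_space D" and c: "c > 0" and a: "a > 0"
    and meas: "\<And>t. (\<lambda>(\<omega>, s). h t \<omega> s) \<in> borel_measurable (PiM {..<t} (\<lambda>_. D) \<Otimes>\<^sub>M D)"
    and adapted: "\<And>t \<omega> \<omega>' s. (\<And>k. k < t \<Longrightarrow> \<omega> k = \<omega>' k) \<Longrightarrow> h t \<omega> s = h t \<omega>' s"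
    and bound: "\<And>t \<omega>. AE s in D. \<bar>h t \<omega> s\<bar> \<le> c"
  defines "g \<equiv> \<lambda>t \<omega> s. (\<integral>s'. h t \<omega> s' \<partial>D) - h t \<omega> s"
  shows "{\<omega> \<in> space (PiM {..<N} (\<lambda>_. D)). real N * a \<le> (\<Sum>t<N. g t \<omega> (\<omega> t))} \<in> sets (PiM {..<N} (\<lambda>_. D))"
    and "measure (PiM {..<N} (\<lambda>_. D))
      {\<omega> \<in> space (PiM {..<N} (\<lambda>_. D)). real N * a \<le> (\<Sum>t<N. g t \<omega> (\<omega> t))}
      \<le> exp (- (real N * a\<^sup>2 / (2 * c\<^sup>2)))"
proof -
  interpret D: prob_space D by (rule D)
  interpret P: product_prob_space "\<lambda>_ :: nat. D" UNIV ..
  interpret PN: prob_space "PiM {..<N} (\<lambda>_. D)" by (rule prob_space_PiM) (rule D)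
  have g_meas: "(\<lambda>(\<omega>, s). g t \<omega> s) \<in> borel_measurable (PiM {..<t} (\<lambda>_. D) \<Otimes>\<^sub>M D)" for t
  proof -
    note [measurable] = meas[of t]
    have [measurable]: "(\<lambda>\<omega>. \<integral>s'. h t \<omega> s' \<partial>D) \<in> borel_measurable (PiM {..<t} (\<lambda>_. D))"
      by (rule D.borel_measurable_lebesgue_integral) (rule meas)
    show ?thesis unfolding g_def by measurable
  qed
  have g_adapted: "g t \<omega> s = g t \<omega>' s" if "\<And>k. k < t \<Longrightarrow> \<omega> k = \<omega>' k" for t \<omega> \<omega>' s
  proof -
    have "h t \<omega> = h t \<omega>'" using that by (intro ext adapted) auto
    then show ?thesis by (simp add: g_def)
  qed
  \<comment> \<open>The minimizer of -l a + l^2 c^2 / 2.\<close>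
  define l where "l = a / c\<^sup>2"
  have l: "l > 0" using a c by (simp add: l_def)
  let ?K = "exp (l\<^sup>2 * c\<^sup>2 / 2)"
  have step: "(\<integral>\<^sup>+s. ennreal (exp (l * g t \<omega> s)) \<partial>D) \<le> ennreal ?K"
    if \<omega>: "\<omega> \<in> space (PiM {..<t} (\<lambda>_. D))" for t \<omega>
  proof -
    have h: "(\<lambda>s. h t \<omega> s) \<in> borel_measurable D"
      using measurable_compose[OF measurable_Pair1'[OF \<omega>] meas[of t]] by simp
    \<comment> \<open>Hoeffding's lemma treats a variable minus its mean; \<open>g\<close> has this
      form for the negated \<open>h\<close>.\<close>
    interpret h: interval_bounded_random_variable D "\<lambda>s. - h t \<omega> s" "- c" c
    proof
      show "(\<lambda>s. - h t \<omega> s) \<in> borel_measurable D" using h by simp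
      show "AE s in D. - h t \<omega> s \<in> {- c..c}"
        using bound[of t \<omega>] by eventually_elim (auto simp: abs_le_iff)
    qed
    have "g t \<omega> s = - h t \<omega> s - D.expectation (\<lambda>s. - h t \<omega> s)" for s
      by (simp add: g_def)
    then have "(\<integral>\<^sup>+s. ennreal (exp (l * g t \<omega> s)) \<partial>D) \<le> ennreal (exp (l\<^sup>2 * (c - - c)\<^sup>2 / 8))"
      using h.Hoeffdings_lemma_nn_integral[OF l] by simp
    also have "l\<^sup>2 * (c - - c)\<^sup>2 / 8 = l\<^sup>2 * c\<^sup>2 / 2"
      by (simp add: power2_eq_square)
    finally show ?thesis .
  qed
  have [measurable]: "(\<lambda>\<omega>. g t \<omega> (\<omega> t)) \<in> borel_measurable (PiM {..<N} (\<lambda>_. D))" if "t < N" for t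
    using measurable_adapted[where g = g, OF g_meas g_adapted that] by blast
  show "{\<omega> \<in> space (PiM {..<N} (\<lambda>_. D)). real N * a \<le> (\<Sum>t<N. g t \<omega> (\<omega> t))} \<in> sets (PiM {..<N} (\<lambda>_. D))"
    by measurable
  have "emeasure (PiM {..<N} (\<lambda>_. D))
      {\<omega> \<in> space (PiM {..<N} (\<lambda>_. D)). real N * a \<le> (\<Sum>t<N. g t \<omega> (\<omega> t))} \<le>
    ennreal (exp (- l * (real N * a))) *
      (\<integral>\<^sup>+\<omega>. ennreal (exp (l * (\<Sum>t<N. g t \<omega> (\<omega> t)))) * indicator (space (PiM {..<N} (\<lambda>_. D))) \<omega> \<partial>(PiM {..<N} (\<lambda>_. D)))"
    using l by (intro Chernoff_ineq_nn_integral_ge) auto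
  also have "(\<integral>\<^sup>+\<omega>. ennreal (exp (l * (\<Sum>t<N. g t \<omega> (\<omega> t)))) * indicator (space (PiM {..<N} (\<lambda>_. D))) \<omega> \<partial>(PiM {..<N} (\<lambda>_. D)))
      = (\<integral>\<^sup>+\<omega>. ennreal (exp (l * (\<Sum>t<N. g t \<omega> (\<omega> t)))) \<partial>(PiM {..<N} (\<lambda>_. D)))"
    by (intro nn_integral_cong) simp
  also have "\<dots> \<le> ennreal ?K ^ N"
    by (rule nn_integral_exp_adapted_sum_le[OF D g_meas g_adapted step])
  also have "ennreal (exp (- l * (real N * a))) * ennreal ?K ^ N =
      ennreal (exp (- l * (real N * a) + real N * (l\<^sup>2 * c\<^sup>2 / 2)))"
    unfolding exp_add exp_of_nat_mult by (simp add: ennreal_power flip: ennreal_mult)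
  also have "- l * (real N * a) + real N * (l\<^sup>2 * c\<^sup>2 / 2) = - (real N * a\<^sup>2 / (2 * c\<^sup>2))"
    using c by (simp add: l_def field_simps power2_eq_square)
  finally show "measure (PiM {..<N} (\<lambda>_. D))
      {\<omega> \<in> space (PiM {..<N} (\<lambda>_. D)). real N * a \<le> (\<Sum>t<N. g t \<omega> (\<omega> t))}
      \<le> exp (- (real N * a\<^sup>2 / (2 * c\<^sup>2)))"
    by (simp add: PN.emeasure_eq_measure mult_left_mono)
qed


section \<open>Measurability of losses and iterates\<close>

text \<open>Costs and demands form a countable discrete space, on which every function is
  measurable. Hence the dual rule, an arbitrary function of both, needs no regularity.\<close>

lemma measurable_cost_demand:
  fixes g :: "(nat \<Rightarrow> nat) \<Rightarrow> (nat \<Rightarrow> nat) \<Rightarrow> real"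
  shows "(\<lambda>s. g (fst s) (fst (snd s))) \<in> borel_measurable (sample_space n E f)"
proof -
  let ?P = "\<lambda>I :: nat set. PiM I (\<lambda>_. count_space (UNIV :: nat set))"
  let ?S = "\<lambda>I :: nat set. PiE I (\<lambda>_. UNIV :: nat set)"
  have P: "?P {..<k} = count_space (?S {..<k})" for k
    by (rule count_space_PiM_finite) auto
  have "countable (?S {..<k})" for k
    by (intro countable_PiE) auto
  then have pair: "?P {..<length E} \<Otimes>\<^sub>M ?P {..<n} = count_space (?S {..<length E} \<times> ?S {..<n})"
    unfolding P by (intro pair_measure_countable)
  have "(\<lambda>s. (fst s, fst (snd s))) \<in> sample_space n E f \<rightarrow>\<^sub>M ?P {..<length E} \<Otimes>\<^sub>M ?P {..<n}"
    unfolding sample_space_def by measurable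
  moreover have "case_prod g \<in> borel_measurable (?P {..<length E} \<Otimes>\<^sub>M ?P {..<n})"
    unfolding pair by simp
  ultimately show ?thesis
    using measurable_compose by fastforce
qed

lemma measurable_feature:
  assumes "j < f"
  shows "(\<lambda>s. snd (snd s) j) \<in> borel_measurable (sample_space n E f)"
proof -
  have j: "j \<in> {..<f}" using assms by simp
  note [measurable] = measurable_component_singleton[OF j, of "\<lambda>_. borel"]
  show ?thesis unfolding sample_space_def by measurable
qed

lemma measurable_loss_subgradient:
  assumes h: "h \<in> M \<rightarrow>\<^sub>M sample_space n E f" and ij: "i < n" "j < f"
    and A: "\<And>i j. i < n \<Longrightarrow> j < f \<Longrightarrow> (\<lambda>x. A x i j) \<in> borel_measurable M"
  shows "(\<lambda>x. loss_subgradient xs n E f (h x) (A x) i j) \<in> borel_measurable M"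
proof -
  note [measurable] = measurable_compose[OF h measurable_cost_demand]
    measurable_compose[OF h measurable_feature] A
  have "(\<lambda>x. (if (\<Sum>j<f. A x i j * snd (snd (h x)) j) < real_of_int (xs n E (fst (h x)) (fst (snd (h x))) i)
      then - real (fst (snd (h x)) i) else real (fst (snd (h x)) i)) * snd (snd (h x)) j) \<in> borel_measurable M"
    using ij by measurable
  then show ?thesis by (simp add: loss_subgradient_def split_beta mat_vec_def)
qed

lemma measurable_loss:
  assumes h: "h \<in> M \<rightarrow>\<^sub>M sample_space n E f"
    and A: "\<And>i j. i < n \<Longrightarrow> j < f \<Longrightarrow> (\<lambda>x. A x i j) \<in> borel_measurable M"
  shows "(\<lambda>x. loss xs n E f (h x) (A x)) \<in> borel_measurable M"
proof -
  note [measurable] = measurable_compose[OF h measurable_cost_demand]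
    measurable_compose[OF h measurable_feature] A
  have "(\<lambda>x. \<Sum>i<n. real (fst (snd (h x)) i) *
      \<bar>(\<Sum>j<f. A x i j * snd (snd (h x)) j) - real_of_int (xs n E (fst (h x)) (fst (snd (h x))) i)\<bar>)
      \<in> borel_measurable M"
    by measurable
  then show ?thesis by (simp add: loss_def seminorm1_def split_beta mat_vec_def)
qed

lemma measurable_ogd_seq:
  assumes D: "sets D = sets (sample_space n E f)" and t: "t \<le> N" and ij: "i < n" "j < f"
  shows "(\<lambda>\<omega>. ogd_seq xs n E f C \<alpha> \<omega> t i j) \<in> borel_measurable (PiM {..<N} (\<lambda>_. D))"
  using t ij
proof (induction t arbitrary: i j)
  case 0
  then show ?case by simp
next
  case (Suc t)
  have h: "(\<lambda>\<omega>. \<omega> t) \<in> PiM {..<N} (\<lambda>_. D) \<rightarrow>\<^sub>M sample_space n E f"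
    using Suc.prems by (subst measurable_cong_sets[OF refl D[symmetric]])
      (auto intro: measurable_component_singleton)
  have [measurable]: "(\<lambda>\<omega>. ogd_seq xs n E f C \<alpha> \<omega> t i j) \<in> borel_measurable (PiM {..<N} (\<lambda>_. D))"
    using Suc by simp
  have [measurable]: "(\<lambda>\<omega>. loss_subgradient xs n E f (\<omega> t) (ogd_seq xs n E f C \<alpha> \<omega> t) i j)
      \<in> borel_measurable (PiM {..<N} (\<lambda>_. D))"
    using Suc by (intro measurable_loss_subgradient[OF h]) auto
  show ?case unfolding ogd_seq.simps clip_def by measurable
qed

text \<open>Iterate t precedes sample t. This is the adaptedness that the martingale bound
  requires.\<close>

lemma ogd_seq_cong:
  "(\<And>k. k < t \<Longrightarrow> \<omega> k = \<omega>' k) \<Longrightarrow> ogd_seq xs n E f C \<alpha> \<omega> t = ogd_seq xs n E f C \<alpha> \<omega>' t"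
  by (induction t) auto

lemma ogd_seq_mat_box:
  assumes "C \<ge> 0"
  shows "ogd_seq xs n E f C \<alpha> \<omega> t \<in> mat_box n f C"
  using assms clip_bounds[OF assms] by (cases t) (auto simp: mat_box_def)

lemma ogd_average_mat_box:
  assumes C: "C \<ge> 0" and N: "N \<ge> 1"
  shows "ogd_average xs n E f C \<alpha> \<omega> N \<in> mat_box n f C"
proof -
  have "ogd_average xs n E f C \<alpha> \<omega> N i j \<in> {- C..C}" if "i < n" "j < f" for i j
  proof -
    have b: "ogd_seq xs n E f C \<alpha> \<omega> t i j \<in> {- C..C}" for t
      using ogd_seq_mat_box[OF C, of xs n E f \<alpha> \<omega> t] that by (simp add: mat_box_def)
    have "(\<Sum>t<N. - C) \<le> (\<Sum>t<N. ogd_seq xs n E f C \<alpha> \<omega> t i j)"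
      "(\<Sum>t<N. ogd_seq xs n E f C \<alpha> \<omega> t i j) \<le> (\<Sum>t<N. C)"
      using b by (intro sum_mono; simp)+
    then show ?thesis using N by (simp add: ogd_average_def field_simps)
  qed
  then show ?thesis by (simp add: mat_box_def)
qed

lemma ogd_seq_regret:
  assumes \<alpha>: "\<alpha> > 0" and B: "B \<ge> 0" and v: "\<And>t. t < N \<Longrightarrow> valid_sample n E f C B (\<omega> t)"
    and Z: "Z \<in> mat_box n f C"
  shows "(\<Sum>t<N. loss xs n E f (\<omega> t) (ogd_seq xs n E f C \<alpha> \<omega> t) - loss xs n E f (\<omega> t) Z)
    \<le> real n * real f * C\<^sup>2 / (2 * \<alpha>) + \<alpha> * real N * (real n * B\<^sup>2) / 2"
proof -
  let ?A = "ogd_seq xs n E f C \<alpha> \<omega>"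
  let ?G = "\<lambda>t. loss_subgradient xs n E f (\<omega> t) (?A t)"
  have "(\<Sum>t<N. loss xs n E f (\<omega> t) (?A t) - loss xs n E f (\<omega> t) Z) \<le>
      (\<Sum>t<N. frob_inner n f (?G t) (\<lambda>i j. ?A t i j - Z i j))"
    by (intro sum_mono subgradient_diff_le is_subgradient_loss)
  also have "\<dots> \<le> real n * real f * C\<^sup>2 / (2 * \<alpha>) + \<alpha> * real N * (real n * B\<^sup>2) / 2"
    by (rule clipped_descent_regret[OF \<alpha> _ _ _ Z])
      (auto intro: subgradient_norm_bound[OF is_subgradient_loss v B])
  finally show ?thesis .
qed

text \<open>Jensen's inequality for the convex loss, by the triangle inequality in each row.\<close>

lemma loss_average_le:
  assumes N: "N \<ge> 1"
  shows "loss xs n E f s (\<lambda>i j. (\<Sum>t<N. A t i j) / real N) \<le> (\<Sum>t<N. loss xs n E f s (A t)) / real N"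
proof -
  obtain c b \<phi> where s: "s = (c, b, \<phi>)" by (metis surj_pair)
  have row: "\<bar>mat_vec f (\<lambda>i j. (\<Sum>t<N. A t i j) / real N) \<phi> i - x\<bar> \<le> (\<Sum>t<N. \<bar>mat_vec f (A t) \<phi> i - x\<bar>) / real N"
    for i x
  proof -
    have "mat_vec f (\<lambda>i j. (\<Sum>t<N. A t i j) / real N) \<phi> i = (\<Sum>t<N. mat_vec f (A t) \<phi> i) / real N"
      unfolding mat_vec_def sum_divide_distrib sum_distrib_right
      by (subst sum.swap) (simp add: mult.commute)
    also have "\<dots> - x = (\<Sum>t<N. mat_vec f (A t) \<phi> i - x) / real N"
      using N by (simp add: sum_subtractf diff_divide_distrib)
    finally show ?thesis
      using N by (simp add: abs_divide divide_right_mono sum_abs)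
  qed
  have "loss xs n E f s (\<lambda>i j. (\<Sum>t<N. A t i j) / real N) \<le>
      (\<Sum>i<n. real (b i) * ((\<Sum>t<N. \<bar>mat_vec f (A t) \<phi> i - real_of_int (xs n E c b i)\<bar>) / real N))"
    unfolding s loss_def seminorm1_def prod.case by (intro sum_mono mult_left_mono row) auto
  also have "\<dots> = (\<Sum>t<N. loss xs n E f s (A t)) / real N"
    unfolding s loss_def seminorm1_def prod.case
    by (subst sum.swap) (simp add: sum_distrib_left sum_divide_distrib)
  finally show ?thesis .
qed

section \<open>The risk\<close>

context
  fixes xs :: dual_rule and n :: nat and E :: edges and f :: nat and C B :: real and D :: "sample measure"
  assumes D: "sample_distribution n E f C B D" and C: "C \<ge> 0" and B: "B \<ge> 0"
begin

lemma prob_space_D: "prob_space D"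
  and sets_D: "sets D = sets (sample_space n E f)"
  and AE_valid: "AE s in D. valid_sample n E f C B s"
  using D by (auto simp: sample_distribution_def)

interpretation prob_space D by (rule prob_space_D)

text \<open>No explicit bound on x* is available, but only finitely many integral pairs (c, b)
  respect the bounds, so the loss of the zero matrix is bounded; the Lipschitz estimate transfers
  this to any other matrix.\<close>

lemma integrable_loss: "integrable D (\<lambda>s. loss xs n E f s A)"
proof -
  define S :: "((nat \<Rightarrow> nat) \<times> (nat \<Rightarrow> nat)) set" where
    "S = PiE {..<length E} (\<lambda>_. {..nat \<lfloor>C\<rfloor>}) \<times> PiE {..<n} (\<lambda>_. {..nat \<lfloor>B\<rfloor>})"
  have "finite S" unfolding S_def by (intro finite_cartesian_product finite_PiE) auto
  let ?x = "\<lambda>p. \<bar>\<Sum>i<n. real (snd p i) * \<bar>- real_of_int (xs n E (fst p) (snd p) i)\<bar>\<bar>"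
  obtain K where K: "\<And>p. p \<in> S \<Longrightarrow> ?x p \<le> K"
    using finite_imageI[OF \<open>finite S\<close>, of ?x] bdd_above_finite[of "?x ` S"]
    unfolding bdd_above_def by blast
  have "\<bar>loss xs n E f s A\<bar> \<le> K + B * (\<Sum>i<n. \<Sum>j<f. \<bar>A i j\<bar>)" if v: "valid_sample n E f C B s" for s
  proof -
    obtain c b \<phi> where s: "s = (c, b, \<phi>)" by (metis surj_pair)
    have "(c, b) \<in> S"
      using v unfolding s valid_sample_def matching_instance_def S_def
      by (auto simp: PiE_iff le_nat_floor)
    from K[OF this] have "\<bar>loss xs n E f s (\<lambda>i j. 0)\<bar> \<le> K"
      by (simp add: s loss_def seminorm1_def mat_vec_def)
    then show ?thesis
      using valid_sample_loss_lipschitz[OF v B, of xs A "\<lambda>i j. 0"] by simp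
  qed
  then show ?thesis
    using AE_valid
    by (intro integrable_const_bound[where B = "K + B * (\<Sum>i<n. \<Sum>j<f. \<bar>A i j\<bar>)"])
      (auto elim!: eventually_mono intro!: measurable_loss simp: measurable_ident_sets sets_D)
qed

lemma risk_diff_le:
  assumes "\<And>s. valid_sample n E f C B s \<Longrightarrow> loss xs n E f s A' - loss xs n E f s A \<le> k"
  shows "risk xs n E f D A' - risk xs n E f D A \<le> k"
proof -
  have "risk xs n E f D A' - risk xs n E f D A = (\<integral>s. loss xs n E f s A' - loss xs n E f s A \<partial>D)"
    unfolding risk_def by (intro Bochner_Integration.integral_diff[symmetric] integrable_loss)
  also have "\<dots> \<le> k"
    using AE_valid assms
    by (intro integral_le_const Bochner_Integration.integrable_diff integrable_loss) (auto elim!: eventually_mono)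
  finally show ?thesis .
qed

lemma ex_risk_minimizer:
  assumes "n \<ge> 1" "f \<ge> 1"
  shows "\<exists>A\<^sub>0. is_arg_min (risk xs n E f D) (\<lambda>A. max_norm n f A \<le> C) A\<^sub>0"
proof (rule ex_arg_min_max_norm[OF assms C])
  fix A A'
  have le: "risk xs n E f D A' - risk xs n E f D A \<le> B * (\<Sum>i<n. \<Sum>j<f. \<bar>A' i j - A i j\<bar>)" for A A'
    using valid_sample_loss_lipschitz[OF _ B] by (intro risk_diff_le) (meson abs_le_D1)
  show "\<bar>risk xs n E f D A' - risk xs n E f D A\<bar> \<le> B * (\<Sum>i<n. \<Sum>j<f. \<bar>A' i j - A i j\<bar>)"
    using le[of A' A] le[of A A'] by (simp add: abs_le_iff abs_minus_commute)
qed

lemma risk_diff_mat_box: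
  assumes "A \<in> mat_box n f C" "A' \<in> mat_box n f C"
  shows "risk xs n E f D A' - risk xs n E f D A \<le> 2 * (C * B * real n)"
  using loss_diff_mat_box[OF _ C assms] by (intro risk_diff_le) (meson abs_le_D1)

lemma risk_average_le:
  assumes N: "N \<ge> 1"
  shows "risk xs n E f D (\<lambda>i j. (\<Sum>t<N. A t i j) / real N) \<le> (\<Sum>t<N. risk xs n E f D (A t)) / real N"
proof -
  have "risk xs n E f D (\<lambda>i j. (\<Sum>t<N. A t i j) / real N) \<le>
      (\<integral>s. (\<Sum>t<N. loss xs n E f s (A t)) / real N \<partial>D)"
    unfolding risk_def
    by (intro integral_mono Bochner_Integration.integrable_divide Bochner_Integration.integrable_sum
      integrable_loss loss_average_le N)
  also have "\<dots> = (\<Sum>t<N. risk xs n E f D (A t)) / real N"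
    unfolding risk_def using integrable_loss by simp
  finally show ?thesis .
qed

text \<open>
  Online-to-batch conversion: up to a martingale, the excess risk of the averaged iterate is the average
  regret of the iterates on the sample.
\<close>

lemma ogd_average_excess_risk:
  assumes N: "N \<ge> 1" and \<alpha>: "\<alpha> > 0" and a: "a > 0" and R: "C * B * real n > 0"
    and Z: "Z \<in> mat_box n f C"
    and reg: "real n * real f * C\<^sup>2 / (2 * \<alpha>) + \<alpha> * real N * (real n * B\<^sup>2) / 2 \<le> real N * a"
  shows "measure (PiM {..<N} (\<lambda>_. D)) {\<omega> \<in> space (PiM {..<N} (\<lambda>_. D)).
      risk xs n E f D (ogd_average xs n E f C \<alpha> \<omega> N) \<le> risk xs n E f D Z + 2 * a}
    \<ge> 1 - exp (- (real N * a\<^sup>2 / (8 * (C * B * real n)\<^sup>2)))"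
proof -
  interpret PN: prob_space "PiM {..<N} (\<lambda>_. D)" by (rule prob_space_PiM) (rule prob_space_D)
  let ?P = "PiM {..<N} (\<lambda>_. D)"
  let ?A = "\<lambda>\<omega>. ogd_seq xs n E f C \<alpha> \<omega>"
  let ?L = "loss xs n E f" and ?r = "risk xs n E f D"
  \<comment> \<open>Excess over the comparator rather than the loss itself, since only this is
    bounded by 2 C B n; it gives 8 (C B n)^2 in the exponent.\<close>
  define h where "h t \<omega> s = ?L s (?A \<omega> t) - ?L s Z" for t \<omega> s
  define g where "g t \<omega> s = (\<integral>s'. h t \<omega> s' \<partial>D) - h t \<omega> s" for t \<omega> s
  let ?bad = "{\<omega> \<in> space ?P. real N * a \<le> (\<Sum>t<N. g t \<omega> (\<omega> t))}"
  let ?good = "{\<omega> \<in> space ?P. ?r (ogd_average xs n E f C \<alpha> \<omega> N) \<le> ?r Z + 2 * a}"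
  have h_meas: "(\<lambda>(\<omega>, s). h t \<omega> s) \<in> borel_measurable (PiM {..<t} (\<lambda>_. D) \<Otimes>\<^sub>M D)" for t
  proof -
    let ?M = "PiM {..<t} (\<lambda>_. D) \<Otimes>\<^sub>M D"
    have snd: "snd \<in> ?M \<rightarrow>\<^sub>M sample_space n E f"
      by (subst measurable_cong_sets[OF refl sets_D[symmetric]]) measurable
    have [measurable]: "(\<lambda>x. ?L (snd x) (?A (fst x) t)) \<in> borel_measurable ?M"
      by (intro measurable_loss[OF snd] measurable_compose[OF measurable_fst measurable_ogd_seq[OF sets_D]]) auto
    have [measurable]: "(\<lambda>x. ?L (snd x) Z) \<in> borel_measurable ?M"
      by (intro measurable_loss[OF snd]) auto
    show ?thesis unfolding h_def split_beta by measurable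
  qed
  have h_adapted: "h t \<omega> s = h t \<omega>' s" if "\<And>k. k < t \<Longrightarrow> \<omega> k = \<omega>' k" for t \<omega> \<omega>' s
    using ogd_seq_cong[of t \<omega> \<omega>' xs n E f C \<alpha>] that by (simp add: h_def)
  have h_bound: "AE s in D. \<bar>h t \<omega> s\<bar> \<le> 2 * (C * B * real n)" for t \<omega>
    using AE_valid
    by eventually_elim (auto simp: h_def intro!: loss_diff_mat_box C Z ogd_seq_mat_box)
  note azuma = azuma_adapted_sum[OF prob_space_D _ a h_meas h_adapted h_bound, folded g_def, of N]
  have bad_sets: "?bad \<in> PN.events" using azuma(1) R by simp
  have bad: "PN.prob ?bad \<le> exp (- (real N * a\<^sup>2 / (8 * (C * B * real n)\<^sup>2)))"
    using azuma(2) R by (simp add: power_mult_distrib)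
  have good_sets: "?good \<in> PN.events"
  proof -
    have "(\<lambda>(\<omega>, s). ?L s (ogd_average xs n E f C \<alpha> \<omega> N)) \<in> borel_measurable (?P \<Otimes>\<^sub>M D)"
      unfolding split_beta
    proof (rule measurable_loss)
      show "snd \<in> ?P \<Otimes>\<^sub>M D \<rightarrow>\<^sub>M sample_space n E f"
        by (subst measurable_cong_sets[OF refl sets_D[symmetric]]) measurable
      fix i j assume ij: "i < n" "j < f"
      show "(\<lambda>x. ogd_average xs n E f C \<alpha> (fst x) N i j) \<in> borel_measurable (?P \<Otimes>\<^sub>M D)"
        unfolding ogd_average_def
        by (intro borel_measurable_divide borel_measurable_sum borel_measurable_const
          measurable_compose[OF measurable_fst measurable_ogd_seq[OF sets_D _ ij]]) auto
    qed
    then have [measurable]: "(\<lambda>\<omega>. ?r (ogd_average xs n E f C \<alpha> \<omega> N)) \<in> borel_measurable ?P"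
      unfolding risk_def by (rule borel_measurable_lebesgue_integral)
    show ?thesis by measurable
  qed
  \<comment> \<open>The regret bound needs valid samples, which are guaranteed only almost surely;
    hence the complement of the bad event lies in the good one up to a null set.\<close>
  have "AE \<omega> in ?P. \<forall>t\<in>{..<N}. valid_sample n E f C B (\<omega> t)"
    by (intro AE_finite_allI AE_PiM_component AE_valid prob_space_D) auto
  then have "AE \<omega> in ?P. \<omega> \<in> space ?P - ?bad \<longrightarrow> \<omega> \<in> ?good"
  proof eventually_elim
    case (elim \<omega>)
    show ?case
    proof
      assume \<omega>: "\<omega> \<in> space ?P - ?bad"
      have "(\<Sum>t<N. ?r (?A \<omega> t)) - real N * ?r Z = (\<Sum>t<N. g t \<omega> (\<omega> t)) + (\<Sum>t<N. h t \<omega> (\<omega> t))"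
      proof -
        have "(\<integral>s. h t \<omega> s \<partial>D) = ?r (?A \<omega> t) - ?r Z" for t
          unfolding h_def risk_def by (intro Bochner_Integration.integral_diff integrable_loss)
        then show ?thesis by (simp add: g_def sum_subtractf)
      qed
      also have "(\<Sum>t<N. h t \<omega> (\<omega> t)) \<le> real N * a"
        using ogd_seq_regret[OF \<alpha> B _ Z, where N = N and \<omega> = \<omega> and E = E and xs = xs] elim reg unfolding h_def by simp
      also have "(\<Sum>t<N. g t \<omega> (\<omega> t)) \<le> real N * a"
        using \<omega> by auto
      finally have "(\<Sum>t<N. ?r (?A \<omega> t)) / real N \<le> ?r Z + 2 * a"
        using N by (simp add: field_simps)
      moreover have "?r (ogd_average xs n E f C \<alpha> \<omega> N) \<le> (\<Sum>t<N. ?r (?A \<omega> t)) / real N"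
        unfolding ogd_average_def by (rule risk_average_le[OF N])
      ultimately show "\<omega> \<in> ?good" using \<omega> by auto
    qed
  qed
  then have "PN.prob (space ?P - ?bad) \<le> PN.prob ?good"
    by (intro PN.finite_measure_mono_AE good_sets)
  then show ?thesis
    using PN.prob_compl[OF bad_sets] bad by linarith
qed

end


section \<open>The sample complexity\<close>

lemma ogd_learner_nth:
  "ogd_learner xs (n, E, f, C, B, \<epsilon>, \<delta>, map \<omega> [0..<N]) =
    ogd_average xs n E f C (\<epsilon> / (2 * real n * B\<^sup>2)) \<omega> N"
proof -
  have "ogd_seq xs n E f C \<alpha> (nth (map \<omega> [0..<N])) t = ogd_seq xs n E f C \<alpha> \<omega> t" if "t < N" for t \<alpha>
    using that by (intro ogd_seq_cong) auto
  then show ?thesis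
    by (simp add: ogd_learner_def ogd_average_def)
qed

lemma sample_complexity:
  assumes n: "n \<ge> 1" and f: "f \<ge> 1" and C: "C \<ge> 0" and B: "B \<ge> 0" and \<epsilon>: "\<epsilon> > 0" and \<delta>: "\<delta> > 0"
  shows "\<exists>N \<ge> 1.
    real N \<le> max 1 (64 * (C * B * real n / \<epsilon>)\<^sup>2 * ((real f)\<^sup>2 + ln (1 / \<delta>))) \<and>
    (\<forall>D. sample_distribution n E f C B D \<longrightarrow>
      (\<exists>A\<^sub>0. is_arg_min (risk xs n E f D) (\<lambda>A. max_norm n f A \<le> C) A\<^sub>0 \<and>
        measure (\<Pi>\<^sub>M k\<in>{..<N}. D)
          {\<omega> \<in> space (\<Pi>\<^sub>M k\<in>{..<N}. D).
            risk xs n E f D (ogd_learner xs (n, E, f, C, B, \<epsilon>, \<delta>, map \<omega> [0..<N]))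
              \<le> risk xs n E f D A\<^sub>0 + \<epsilon>} \<ge> 1 - \<delta>))"
proof -
  define R where "R = C * B * real n"
  define X where "X = (R / \<epsilon>)\<^sup>2 * ((real f)\<^sup>2 + ln (1 / \<delta>))"
  \<comment> \<open>Rounding down respects the upper bound on N.\<close>
  define N where "N = (if 64 * X < 1 then 1 else nat \<lfloor>64 * X\<rfloor>)"
  have R: "R \<ge> 0" using C B by (simp add: R_def)
  have N1: "N \<ge> 1" by (auto simp: N_def le_nat_iff)
  have N_le: "real N \<le> max 1 (64 * X)" by (auto simp: N_def)
  have "\<exists>A\<^sub>0. is_arg_min (risk xs n E f D) (\<lambda>A. max_norm n f A \<le> C) A\<^sub>0 \<and>
        measure (\<Pi>\<^sub>M k\<in>{..<N}. D)
          {\<omega> \<in> space (\<Pi>\<^sub>M k\<in>{..<N}. D).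
            risk xs n E f D (ogd_learner xs (n, E, f, C, B, \<epsilon>, \<delta>, map \<omega> [0..<N]))
              \<le> risk xs n E f D A\<^sub>0 + \<epsilon>} \<ge> 1 - \<delta>"
    if D: "sample_distribution n E f C B D" for D
  proof -
    obtain A\<^sub>0 where A0: "is_arg_min (risk xs n E f D) (\<lambda>A. max_norm n f A \<le> C) A\<^sub>0"
      using ex_risk_minimizer[OF D C B n f] by blast
    then have box: "A\<^sub>0 \<in> mat_box n f C"
      by (simp add: is_arg_min_def max_norm_le_iff[OF n f])
    interpret PN: prob_space "PiM {..<N} (\<lambda>_. D)"
      by (rule prob_space_PiM) (rule prob_space_D[OF D C B])
    let ?\<alpha> = "\<epsilon> / (2 * real n * B\<^sup>2)"
    let ?G = "{\<omega> \<in> space (PiM {..<N} (\<lambda>_. D)).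
      risk xs n E f D (ogd_average xs n E f C ?\<alpha> \<omega> N) \<le> risk xs n E f D A\<^sub>0 + \<epsilon>}"
    have "1 - \<delta> \<le> PN.prob ?G"
    \<comment> \<open>A confidence requirement 1 - \<delta> \<le> 0 is void; this also removes the
      case of a negative logarithm.\<close>
    proof (cases "\<delta> \<ge> 1")
      case True
      then show ?thesis using measure_nonneg[of "PiM {..<N} (\<lambda>_. D)" ?G] by linarith
    next
      case False
      have ln: "ln (1 / \<delta>) \<ge> 0" using False \<delta> by simp
      have f2: "(real f)\<^sup>2 \<ge> real f" "real f \<ge> 1" using f by (auto simp: power2_eq_square)
      show ?thesis
      \<comment> \<open>In this case 2 C B n \<le> \<epsilon>, so all matrices in the box have risks
        within \<epsilon> of each other and any output is good enough.\<close>
      proof (cases "64 * X < 1")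
        case True
        have "1 \<le> (real f)\<^sup>2 + ln (1 / \<delta>)" using ln f2 by linarith
        then have "(R / \<epsilon>)\<^sup>2 * 1 \<le> X"
          unfolding X_def by (intro mult_left_mono) auto
        then have "(2 * R / \<epsilon>)\<^sup>2 \<le> 1\<^sup>2" using True by (simp add: power_mult_distrib power_divide)
        then have "2 * R / \<epsilon> \<le> 1" by (rule power2_le_imp_le) simp
        then have "2 * R \<le> \<epsilon>" using \<epsilon> by (simp add: field_simps)
        moreover have "risk xs n E f D (ogd_average xs n E f C ?\<alpha> \<omega> N) - risk xs n E f D A\<^sub>0 \<le> 2 * R" for \<omega>
          unfolding R_def by (rule risk_diff_mat_box[OF D C B box ogd_average_mat_box[OF C N1]])
        ultimately have "risk xs n E f D (ogd_average xs n E f C ?\<alpha> \<omega> N) \<le> risk xs n E f D A\<^sub>0 + \<epsilon>" for \<omega>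
          by (smt (verit))
        then have "?G = space (PiM {..<N} (\<lambda>_. D))" by blast
        then show ?thesis using PN.prob_space \<delta> by simp
      next
        case False
        have floor: "1 \<le> \<lfloor>64 * X\<rfloor>" using False by (simp add: le_floor_iff)
        then have "real N = real_of_int \<lfloor>64 * X\<rfloor>" using False by (simp add: N_def)
        moreover have "1 \<le> real_of_int \<lfloor>64 * X\<rfloor>" using floor by linarith
        moreover have "64 * X < real_of_int \<lfloor>64 * X\<rfloor> + 1" by linarith
        \<comment> \<open>Rounding down a number that is at least 1 loses less than half of
          it.\<close>
        ultimately have N32: "32 * X \<le> real N" by linarith
        have "R \<noteq> 0" using False by (auto simp: X_def)
        then have Rpos: "C * B * real n > 0" using R unfolding R_def by linarith
        then have "B > 0" using B by (cases "B = 0") auto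
        have reg: "real n * real f * C\<^sup>2 / (2 * ?\<alpha>) + ?\<alpha> * real N * (real n * B\<^sup>2) / 2 \<le> real N * (\<epsilon> / 2)"
        proof -
          have "4 * (R / \<epsilon>)\<^sup>2 * real f \<le> 32 * X"
          proof -
            have "(R / \<epsilon>)\<^sup>2 * real f \<le> X"
              unfolding X_def using f2 ln by (intro mult_left_mono) (linarith, simp)
            moreover have "0 \<le> (R / \<epsilon>)\<^sup>2 * real f" by simp
            ultimately show ?thesis by linarith
          qed
          with N32 have "4 * (R / \<epsilon>)\<^sup>2 * real f \<le> real N" by linarith
          \<comment> \<open>The two regret terms get \<epsilon>/4 per round each: the distance term
            by the size of N, the gradient term exactly by the choice of step-size.\<close>
          then have "(4 * (R / \<epsilon>)\<^sup>2 * real f) * (\<epsilon> / 4) \<le> real N * (\<epsilon> / 4)"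
            using \<epsilon> by (intro mult_right_mono) auto
          moreover have "real n * real f * C\<^sup>2 / (2 * ?\<alpha>) = (4 * (R / \<epsilon>)\<^sup>2 * real f) * (\<epsilon> / 4)"
            using \<epsilon> \<open>B > 0\<close> n by (simp add: R_def field_simps power2_eq_square)
          moreover have "?\<alpha> * real N * (real n * B\<^sup>2) / 2 = real N * (\<epsilon> / 4)"
            using \<open>B > 0\<close> n by (simp add: field_simps)
          ultimately show ?thesis by simp
        qed
        have conf: "exp (- (real N * (\<epsilon> / 2)\<^sup>2 / (8 * (C * B * real n)\<^sup>2))) \<le> \<delta>"
        proof -
          \<comment> \<open>The factor 32 is 4 times 8: from the squared deviation (\<epsilon>/2)^2
            and from the 8 R^2 of the tail bound.\<close>
          have "32 * ((R / \<epsilon>)\<^sup>2 * ln (1 / \<delta>)) \<le> 32 * X"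
            unfolding X_def by (intro mult_left_mono) auto
          with N32 have "32 * ((R / \<epsilon>)\<^sup>2 * ln (1 / \<delta>)) \<le> real N" by linarith
          then have "ln (1 / \<delta>) \<le> real N * (\<epsilon> / 2)\<^sup>2 / (8 * R\<^sup>2)"
            using \<epsilon> Rpos[folded R_def] by (simp add: field_simps power2_eq_square)
          then have "- (real N * (\<epsilon> / 2)\<^sup>2 / (8 * R\<^sup>2)) \<le> ln \<delta>"
            using \<delta> by (simp add: ln_div)
          then show ?thesis using \<delta> by (metis R_def exp_le_cancel_iff exp_ln)
        qed
        have "1 - exp (- (real N * (\<epsilon> / 2)\<^sup>2 / (8 * (C * B * real n)\<^sup>2))) \<le> PN.prob ?G"
          using ogd_average_excess_risk[OF D C B N1 _ _ Rpos box reg, of xs] \<epsilon> \<open>B > 0\<close> n by simp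
        with conf show ?thesis by linarith
      qed
    qed
    with A0 show ?thesis unfolding ogd_learner_nth by blast
  qed
  with N1 N_le show ?thesis unfolding X_def R_def by (intro exI[of _ N]) (simp add: mult.assoc)
qed

theorem theoremC1:
  shows
    "(\<exists>K > 0. \<forall>xs. poly_time_dual_rule xs \<longrightarrow>
       (\<exists>learner. poly_time_learner learner \<and>
         (\<forall>n E f C B \<epsilon> \<delta>.
           bipartite_graph n E \<and> n \<ge> 3 \<and> length E \<ge> 1 \<and> f \<ge> 1 \<and> C \<ge> 0 \<and> B \<ge> 0 \<and>
           \<epsilon> > 0 \<and> \<delta> > 0 \<longrightarrow>
           (\<exists>N \<ge> 1.
             real N \<le> max 1 (K * (C * B * real n / \<epsilon>)\<^sup>2 * ((real f)\<^sup>2 + ln (1 / \<delta>))) \<and>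
             (\<forall>D. sample_distribution n E f C B D \<longrightarrow>
               (\<exists>A\<^sub>0. is_arg_min (risk xs n E f D) (\<lambda>A. max_norm n f A \<le> C) A\<^sub>0 \<and>
                 measure (\<Pi>\<^sub>M k\<in>{..<N}. D)
                   {\<omega> \<in> space (\<Pi>\<^sub>M k\<in>{..<N}. D).
                     risk xs n E f D (learner (n, E, f, C, B, \<epsilon>, \<delta>, map \<omega> [0..<N]))
                       \<le> risk xs n E f D A\<^sub>0 + \<epsilon>} \<ge> 1 - \<delta>))))))
     \<and>
     (\<forall>n f T C B. n \<ge> 3 \<and> f \<ge> 1 \<and> C \<ge> 0 \<and> B \<ge> 0 \<longrightarrow>
       (\<exists>\<alpha> > 0. \<forall>xs E S As.
         poly_time_dual_rule xs \<and> bipartite_graph n E \<and> length E \<ge> 1 \<and>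
         (\<forall>t<T. valid_sample n E f C B (S t)) \<and>
         ogd_iterates n f (mat_box n f C) \<alpha> T (\<lambda>t. loss xs n E f (S t)) As \<longrightarrow>
         (\<exists>A\<^sub>0. is_arg_max (regret T (\<lambda>t. loss xs n E f (S t)) As)
                 (\<lambda>A. max_norm n f A \<le> C) A\<^sub>0 \<and>
               regret T (\<lambda>t. loss xs n E f (S t)) As A\<^sub>0
                 \<le> C * B * real n * real f * sqrt (2 * real T))))"
proof (rule conjI, goal_cases)
  case 1
  have "\<exists>learner. poly_time_learner learner \<and>
      (\<forall>n E f C B \<epsilon> \<delta>.
        bipartite_graph n E \<and> n \<ge> 3 \<and> length E \<ge> 1 \<and> f \<ge> 1 \<and> C \<ge> 0 \<and> B \<ge> 0 \<and>
        \<epsilon> > 0 \<and> \<delta> > 0 \<longrightarrow>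
        (\<exists>N \<ge> 1.
          real N \<le> max 1 (64 * (C * B * real n / \<epsilon>)\<^sup>2 * ((real f)\<^sup>2 + ln (1 / \<delta>))) \<and>
          (\<forall>D. sample_distribution n E f C B D \<longrightarrow>
            (\<exists>A\<^sub>0. is_arg_min (risk xs n E f D) (\<lambda>A. max_norm n f A \<le> C) A\<^sub>0 \<and>
              measure (\<Pi>\<^sub>M k\<in>{..<N}. D)
                {\<omega> \<in> space (\<Pi>\<^sub>M k\<in>{..<N}. D).
                  risk xs n E f D (learner (n, E, f, C, B, \<epsilon>, \<delta>, map \<omega> [0..<N]))
                    \<le> risk xs n E f D A\<^sub>0 + \<epsilon>} \<ge> 1 - \<delta>))))"
    if "poly_time_dual_rule xs" for xs
    by (intro exI[of _ "ogd_learner xs"] conjI poly_time_ogd_learner[OF that] allI impI)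
      (elim conjE, rule sample_complexity, auto)
  then show ?case
    by (intro exI[of _ "64 :: real"] conjI allI impI) auto
next
  case 2
  show ?case
  proof (intro allI impI)
    fix n f T :: nat and C B :: real
    assume "n \<ge> 3 \<and> f \<ge> 1 \<and> C \<ge> 0 \<and> B \<ge> 0"
    then have "n \<ge> 1" "f \<ge> 1" "C \<ge> 0" "B \<ge> 0" by auto
    from online_regret[OF this, of T]
    show "\<exists>\<alpha> > 0. \<forall>xs E S As.
        poly_time_dual_rule xs \<and> bipartite_graph n E \<and> length E \<ge> 1 \<and>
        (\<forall>t<T. valid_sample n E f C B (S t)) \<and>
        ogd_iterates n f (mat_box n f C) \<alpha> T (\<lambda>t. loss xs n E f (S t)) As \<longrightarrow>
        (\<exists>A\<^sub>0. is_arg_max (regret T (\<lambda>t. loss xs n E f (S t)) As) (\<lambda>A. max_norm n f A \<le> C) A\<^sub>0 \<and>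
          regret T (\<lambda>t. loss xs n E f (S t)) As A\<^sub>0 \<le> C * B * real n * real f * sqrt (2 * real T))"
      by meson
  qed
qed

end
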